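(* Let $\mathcal{E}_1,\mathcal{E}_2$ be extremal qubit channels. Then $\mathcal{E}_1\otimes\mathcal{E}_2$ is entanglement-annihilating if and only if $\mathcal{E}_1$ is entanglement-breaking or $\mathcal{E}_2$ is entanglement-breaking.
   Context: A qubit channel is a completely positive trace-preserving linear map on $M_2(\mathbb{C})$. A qubit channel is extremal if it is an extreme point of the convex set of all qubit channels, i.e. it cannot be expressed as a nontrivial convex combination of other qubit channels. A state is a positive semidefinite operator of trace one. A two-qubit channel is called entanglement-annihilating (EA) if it maps every state on $\mathbb{C}^2\otimes\mathbb{C}^2$ to a state that is separable with respect to the partition qubit 1 | qubit 2. A channel $\mathcal{F}$ is called entanglement-breaking (EB) if for every finite-dimensional ancilla and every state $\rho$ of system plus ancilla, $(\mathcal{F}\otimes\mathcal{I}_{\rm anc})[\rho]$ is separable with respect to the partition system | ancilla, where $\mathcal{I}_{\rm anc}$ is the identity channel on the ancilla. *)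

theory Defs
  imports Complex_Main "Jordan_Normal_Form.Matrix"
begin

text \<open>
  Operators on \<open>\<complex>\<^sup>n\<close> are the elements of \<open>carrier_mat n n\<close>, and maps on operators are functions
  on matrices of which only the values on \<open>carrier_mat n n\<close> are meaningful. The order on the
  complex numbers is the one of \<open>Complex_Order\<close>: \<open>0 \<le> z\<close> means that \<open>z\<close> is real and nonnegative.
\<close>

definition psd :: "nat \<Rightarrow> complex mat \<Rightarrow> bool" where
  "psd n A \<longleftrightarrow> A \<in> carrier_mat n n \<and> (\<forall>v\<in>carrier_vec n. 0 \<le> (A *\<^sub>v v) \<bullet>c v)"

definition mtrace :: "complex mat \<Rightarrow> complex" where
  "mtrace A = (\<Sum>i<dim_row A. A $$ (i, i))"

definition state :: "nat \<Rightarrow> complex mat \<Rightarrow> bool" where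
  "state n \<rho> \<longleftrightarrow> psd n \<rho> \<and> mtrace \<rho> = 1"

text \<open>
  The Kronecker product: the basis vector \<open>e\<^sub>i \<otimes> e\<^sub>k\<close> of \<open>\<complex>\<^sup>n \<otimes> \<complex>\<^sup>m\<close> has index \<open>i * m + k\<close>.
\<close>

definition kron :: "complex mat \<Rightarrow> complex mat \<Rightarrow> complex mat" where
  "kron A B = mat (dim_row A * dim_row B) (dim_col A * dim_col B)
     (\<lambda>(r, s). A $$ (r div dim_row B, s div dim_col B) * B $$ (r mod dim_row B, s mod dim_col B))"

definition unit_op :: "nat \<Rightarrow> nat \<Rightarrow> nat \<Rightarrow> complex mat" where
  "unit_op n i j = mat n n (\<lambda>rs. if rs = (i, j) then 1 else 0)"

text \<open>
  \<open>\<Phi> \<otimes> \<Psi>\<close> for linear maps \<open>\<Phi>\<close> on operators on \<open>\<complex>\<^sup>n\<close> and \<open>\<Psi>\<close> on operators on \<open>\<complex>\<^sup>m\<close>, obtained by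
  expanding the argument in the basis of the \<open>unit_op n i j \<otimes> unit_op m k l\<close>; the lemma
  \<open>tensor_map_kron\<close> below is the usual characterization.
\<close>

definition tensor_map ::
  "nat \<Rightarrow> nat \<Rightarrow> (complex mat \<Rightarrow> complex mat) \<Rightarrow> (complex mat \<Rightarrow> complex mat) \<Rightarrow> complex mat \<Rightarrow> complex mat"
  where
  "tensor_map n m \<Phi> \<Psi> X = mat (n * m) (n * m) (\<lambda>rs.
     \<Sum>i<n. \<Sum>j<n. \<Sum>k<m. \<Sum>l<m.
       X $$ (i * m + k, j * m + l) * kron (\<Phi> (unit_op n i j)) (\<Psi> (unit_op m k l)) $$ rs)"

definition linear_map :: "nat \<Rightarrow> (complex mat \<Rightarrow> complex mat) \<Rightarrow> bool" where
  "linear_map n \<Phi> \<longleftrightarrow>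
     (\<forall>X\<in>carrier_mat n n. \<Phi> X \<in> carrier_mat n n) \<and>
     (\<forall>X\<in>carrier_mat n n. \<forall>Y\<in>carrier_mat n n. \<Phi> (X + Y) = \<Phi> X + \<Phi> Y) \<and>
     (\<forall>c. \<forall>X\<in>carrier_mat n n. \<Phi> (c \<cdot>\<^sub>m X) = c \<cdot>\<^sub>m \<Phi> X)"

definition completely_positive :: "nat \<Rightarrow> (complex mat \<Rightarrow> complex mat) \<Rightarrow> bool" where
  "completely_positive n \<Phi> \<longleftrightarrow>
     (\<forall>d X. psd (n * d) X \<longrightarrow> psd (n * d) (tensor_map n d \<Phi> (\<lambda>Y. Y) X))"

definition trace_preserving :: "nat \<Rightarrow> (complex mat \<Rightarrow> complex mat) \<Rightarrow> bool" where
  "trace_preserving n \<Phi> \<longleftrightarrow> (\<forall>X\<in>carrier_mat n n. mtrace (\<Phi> X) = mtrace X)"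

definition channel :: "nat \<Rightarrow> (complex mat \<Rightarrow> complex mat) \<Rightarrow> bool" where
  "channel n \<Phi> \<longleftrightarrow> linear_map n \<Phi> \<and> completely_positive n \<Phi> \<and> trace_preserving n \<Phi>"

definition extremal_channel :: "nat \<Rightarrow> (complex mat \<Rightarrow> complex mat) \<Rightarrow> bool" where
  "extremal_channel n \<Phi> \<longleftrightarrow> channel n \<Phi> \<and>
     (\<forall>\<Phi>\<^sub>1 \<Phi>\<^sub>2. \<forall>t::real. channel n \<Phi>\<^sub>1 \<and> channel n \<Phi>\<^sub>2 \<and> 0 < t \<and> t < 1 \<and>
        (\<forall>X\<in>carrier_mat n n.
           \<Phi> X = complex_of_real t \<cdot>\<^sub>m \<Phi>\<^sub>1 X + complex_of_real (1 - t) \<cdot>\<^sub>m \<Phi>\<^sub>2 X) \<longrightarrow>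
        (\<forall>X\<in>carrier_mat n n. \<Phi>\<^sub>1 X = \<Phi> X \<and> \<Phi>\<^sub>2 X = \<Phi> X))"

text \<open>
  Separability with respect to the partition \<open>\<complex>\<^sup>n | \<complex>\<^sup>m\<close>: a finite convex combination of product
  states.
\<close>

definition separable :: "nat \<Rightarrow> nat \<Rightarrow> complex mat \<Rightarrow> bool" where
  "separable n m \<rho> \<longleftrightarrow>
     (\<exists>(N::nat) (p :: nat \<Rightarrow> real) \<sigma> \<tau>.
        (\<forall>a<N. 0 \<le> p a \<and> state n (\<sigma> a) \<and> state m (\<tau> a)) \<and> (\<Sum>a<N. p a) = 1 \<and>
        \<rho> = mat (n * m) (n * m) (\<lambda>rs. \<Sum>a<N. complex_of_real (p a) * kron (\<sigma> a) (\<tau> a) $$ rs))"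

text \<open>The following two notions are meant for channels.\<close>

definition entanglement_annihilating ::
  "nat \<Rightarrow> nat \<Rightarrow> (complex mat \<Rightarrow> complex mat) \<Rightarrow> bool" where
  "entanglement_annihilating n m \<Phi> \<longleftrightarrow> (\<forall>\<rho>. state (n * m) \<rho> \<longrightarrow> separable n m (\<Phi> \<rho>))"

definition entanglement_breaking :: "nat \<Rightarrow> (complex mat \<Rightarrow> complex mat) \<Rightarrow> bool" where
  "entanglement_breaking n \<Phi> \<longleftrightarrow>
     (\<forall>d \<rho>. state (n * d) \<rho> \<longrightarrow> separable n d (tensor_map n d \<Phi> (\<lambda>Y. Y) \<rho>))"

lemma linear_map_expand:
  assumes L: "linear_map n \<Phi>" and X: "X \<in> carrier_mat n n" and r: "r < n" and s: "s < n"
  shows "\<Phi> X $$ (r, s) = (\<Sum>i<n. \<Sum>j<n. X $$ (i, j) * \<Phi> (unit_op n i j) $$ (r, s))"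
proof -
  have U: "unit_op n i j \<in> carrier_mat n n" for i j by (simp add: unit_op_def)
  have PC: "Y \<in> carrier_mat n n \<Longrightarrow> \<Phi> Y \<in> carrier_mat n n" for Y
    using L by (simp add: linear_map_def)
  have scal: "\<Phi> (c \<cdot>\<^sub>m Y) $$ (r, s) = c * \<Phi> Y $$ (r, s)" if "Y \<in> carrier_mat n n" for c Y
    using L that PC[OF that] r s by (auto simp: linear_map_def)
  have add: "\<Phi> (Y + Z) $$ (r, s) = \<Phi> Y $$ (r, s) + \<Phi> Z $$ (r, s)"
    if "Y \<in> carrier_mat n n" "Z \<in> carrier_mat n n" for Y Z
    using L that PC[OF that(1)] PC[OF that(2)] r s by (auto simp: linear_map_def)
  have part: "\<Phi> (mat n n (\<lambda>q. if q \<in> S then X $$ q else 0)) $$ (r, s)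
      = (\<Sum>q\<in>S. X $$ q * \<Phi> (unit_op n (fst q) (snd q)) $$ (r, s))" if "finite S" for S
    using that
  proof (induction S)
    case empty
    have "mat n n (\<lambda>q. 0) = 0 \<cdot>\<^sub>m X" using X by (intro eq_matI) auto
    then show ?case using scal[OF X, of 0] by simp
  next
    case (insert q S)
    have "mat n n (\<lambda>p. if p \<in> insert q S then X $$ p else 0)
        = (X $$ q) \<cdot>\<^sub>m unit_op n (fst q) (snd q) + mat n n (\<lambda>p. if p \<in> S then X $$ p else 0)"
      using insert.hyps by (intro eq_matI) (auto simp: unit_op_def)
    then show ?case using insert U by (simp add: add scal)
  qed
  have "X = mat n n (\<lambda>q. if q \<in> {..<n} \<times> {..<n} then X $$ q else 0)"
    using X by (intro eq_matI) auto
  then have "\<Phi> X $$ (r, s)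
      = (\<Sum>q\<in>{..<n} \<times> {..<n}. X $$ q * \<Phi> (unit_op n (fst q) (snd q)) $$ (r, s))"
    using part[of "{..<n} \<times> {..<n}"] by simp
  then show ?thesis by (simp add: sum.cartesian_product case_prod_unfold)
qed

lemma tensor_map_kron:
  assumes "linear_map n \<Phi>" "linear_map m \<Psi>" "A \<in> carrier_mat n n" "B \<in> carrier_mat m m"
  shows "tensor_map n m \<Phi> \<Psi> (kron A B) = kron (\<Phi> A) (\<Psi> B)"
proof (intro eq_matI)
  have C: "\<Phi> A \<in> carrier_mat n n" "\<Psi> B \<in> carrier_mat m m"
    "\<And>i j. \<Phi> (unit_op n i j) \<in> carrier_mat n n" "\<And>k l. \<Psi> (unit_op m k l) \<in> carrier_mat m m"
    using assms by (auto simp: linear_map_def unit_op_def)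
  note C' = C[THEN carrier_matD(1)] C[THEN carrier_matD(2)]
    assms(3,4)[THEN carrier_matD(1)] assms(3,4)[THEN carrier_matD(2)]
  show "dim_row (tensor_map n m \<Phi> \<Psi> (kron A B)) = dim_row (kron (\<Phi> A) (\<Psi> B))"
    "dim_col (tensor_map n m \<Phi> \<Psi> (kron A B)) = dim_col (kron (\<Phi> A) (\<Psi> B))"
    by (simp_all add: tensor_map_def kron_def C')
  fix r s assume "r < dim_row (kron (\<Phi> A) (\<Psi> B))" "s < dim_col (kron (\<Phi> A) (\<Psi> B))"
  then have rs: "r < n * m" "s < n * m" by (simp_all add: kron_def C')
  then have m: "m > 0" by (cases m) auto
  have lt: "r div m < n" "s div m < n" "r mod m < m" "s mod m < m"
    using rs m by (auto simp: less_mult_imp_div_less)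
  have idx: "i * m + k < n * m" if "i < n" "k < m" for i k
  proof -
    have "i * m + k < Suc i * m" using that by simp
    also have "\<dots> \<le> n * m" using that by (intro mult_le_mono1) simp
    finally show ?thesis .
  qed
  have "tensor_map n m \<Phi> \<Psi> (kron A B) $$ (r, s)
      = (\<Sum>i<n. \<Sum>j<n. \<Sum>k<m. \<Sum>l<m. (A $$ (i, j) * \<Phi> (unit_op n i j) $$ (r div m, s div m))
           * (B $$ (k, l) * \<Psi> (unit_op m k l) $$ (r mod m, s mod m)))"
    using rs by (auto simp: tensor_map_def kron_def C' idx intro!: sum.cong)
  also have "\<dots> = \<Phi> A $$ (r div m, s div m) * \<Psi> B $$ (r mod m, s mod m)"
    unfolding linear_map_expand[OF assms(1,3) lt(1,2)] linear_map_expand[OF assms(2,4) lt(3,4)]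
    unfolding sum_distrib_right unfolding sum_distrib_left by (rule refl)
  also have "\<dots> = kron (\<Phi> A) (\<Psi> B) $$ (r, s)"
    using rs by (simp add: kron_def C')
  finally show "tensor_map n m \<Phi> \<Psi> (kron A B) $$ (r, s) = kron (\<Phi> A) (\<Psi> B) $$ (r, s)" .
qed

end

theory Submission
  imports Defs
begin

text \<open>
  An extremal qubit channel maps some pure state to a pure state: the null space of its Choi matrix
  contains a product vector. Otherwise the range of the Choi matrix contains nonzero vectors \<open>f\<close> and
  \<open>g\<close> lying over the first and over the second output basis vector, and adding or subtracting
  \<open>(f g\<^sup>* + g f\<^sup>*) / 2\<close> gives two other channels with the given one as midpoint.

  Let \<open>\<Phi>\<close> map \<open>v v\<^sup>*\<close> to \<open>w w\<^sup>*\<close>, and put \<open>y = \<langle>w\<^sup>\<bottom>, \<Phi>(v\<^sup>\<bottom> v\<^sup>*) w\<rangle>\<close>. By positivity and trace preservation this is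
  the only possibly nonzero entry of \<open>\<Phi>(v\<^sup>\<bottom> v\<^sup>*)\<close>. If \<open>y = 0\<close>, then \<open>\<Phi>\<close> measures in the basis
  \<open>v, v\<^sup>\<bottom>\<close> and prepares a state, so it is entanglement-breaking. If \<open>y \<noteq> 0\<close> for both channels, then
  the output for the input vector \<open>v \<otimes> v' + e (v\<^sup>\<bottom> \<otimes> v'\<^sup>\<bottom>)\<close> with small \<open>e > 0\<close> violates the inequality
  \<open>2 |\<rho>\<^bsub>ab,a'b'\<^esub>| \<le> \<rho>\<^bsub>ab',ab'\<^esub> + \<rho>\<^bsub>a'b,a'b\<^esub>\<close> that holds for separable \<open>\<rho>\<close>.
\<close>

section \<open>Positive semidefinite forms\<close>

text \<open>Vectors are functions on all of \<open>nat\<close> of which only the values below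
  \<open>n\<close> count, so calculations with forms carry no dimension conditions. The form is
  conjugate-linear in its first argument.\<close>

definition sform :: "nat \<Rightarrow> (nat \<Rightarrow> nat \<Rightarrow> complex) \<Rightarrow> (nat \<Rightarrow> complex) \<Rightarrow> (nat \<Rightarrow> complex) \<Rightarrow> complex" where
  "sform n A x y = (\<Sum>i<n. \<Sum>j<n. cnj (x i) * A i j * y j)"

definition psd_form :: "nat \<Rightarrow> (nat \<Rightarrow> nat \<Rightarrow> complex) \<Rightarrow> bool" where
  "psd_form n A \<longleftrightarrow> (\<forall>x. 0 \<le> sform n A x x)"

lemma sform_add_right: "sform n A x (\<lambda>i. y i + z i) = sform n A x y + sform n A x z"
  by (simp add: sform_def algebra_simps sum.distrib)

lemma sform_add_left: "sform n A (\<lambda>i. x i + z i) y = sform n A x y + sform n A z y"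
  by (simp add: sform_def algebra_simps sum.distrib)

lemma sform_scale_right: "sform n A x (\<lambda>i. c * y i) = c * sform n A x y"
  by (simp add: sform_def sum_distrib_left mult_ac)

lemma sform_scale_left: "sform n A (\<lambda>i. c * x i) y = cnj c * sform n A x y"
  by (simp add: sform_def sum_distrib_left mult_ac)

lemmas sform_linear = sform_add_right sform_add_left sform_scale_right sform_scale_left

lemma psd_iff_psd_form:
  "psd n A \<longleftrightarrow> A \<in> carrier_mat n n \<and> psd_form n (\<lambda>i j. A $$ (i, j))"
proof (cases "A \<in> carrier_mat n n")
  case True
  have eq: "(A *\<^sub>v v) \<bullet>c v = sform n (\<lambda>i j. A $$ (i, j)) (($) v) (($) v)"
    if v: "v \<in> carrier_vec n" for v
    using True v
    by (auto simp: sform_def scalar_prod_def sum_distrib_left sum_distrib_right mult_ac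
        atLeast0LessThan intro!: sum.cong)
  show ?thesis
  proof
    assume P: "psd n A"
    have "0 \<le> sform n (\<lambda>i j. A $$ (i, j)) x x" for x
    proof -
      have "sform n (\<lambda>i j. A $$ (i, j)) x x
          = sform n (\<lambda>i j. A $$ (i, j)) (($) (vec n x)) (($) (vec n x))"
        by (simp add: sform_def)
      then show ?thesis using P eq[of "vec n x"] by (metis psd_def vec_carrier)
    qed
    then show "A \<in> carrier_mat n n \<and> psd_form n (\<lambda>i j. A $$ (i, j))"
      using True by (simp add: psd_form_def)
  qed (use eq in \<open>auto simp: psd_def psd_form_def\<close>)
qed (simp add: psd_def)

lemma psd_form_cong:
  "(\<And>i j. i < n \<Longrightarrow> j < n \<Longrightarrow> A i j = B i j) \<Longrightarrow> psd_form n A \<longleftrightarrow> psd_form n B"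
  by (simp add: psd_form_def sform_def)

lemma psd_form_Re_nonneg: "psd_form n A \<Longrightarrow> 0 \<le> Re (sform n A x x)"
  by (auto simp: psd_form_def less_eq_complex_def)

lemma psd_form_eq_Re: "psd_form n A \<Longrightarrow> sform n A x x = complex_of_real (Re (sform n A x x))"
  by (auto simp: psd_form_def less_eq_complex_def complex_eq_iff)

text \<open>Polarization: the form is real at \<open>x + y\<close> and at \<open>x + \<i> y\<close>,
  which settles the imaginary and the real part of the identity in turn.\<close>

lemma psd_form_hermitian:
  assumes "psd_form n A"
  shows "sform n A y x = cnj (sform n A x y)"
proof -
  have "Im (sform n A (\<lambda>i. x i + c * y i) (\<lambda>i. x i + c * y i)) = 0" for c
    using assms by (auto simp: psd_form_def less_eq_complex_def)
  from this[of 1] this[of \<i>] psd_form_eq_Re[OF assms, of x] psd_form_eq_Re[OF assms, of y]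
  show ?thesis by (simp add: sform_linear complex_eq_iff algebra_simps)
qed

text \<open>Positivity at \<open>s x - t (cnj c) y\<close> with real \<open>s\<close> and
  \<open>t\<close>: the factor \<open>cnj c\<close> makes the cross terms real, so no phase has to
  be split off.\<close>

lemma psd_form_cauchy_schwarz:
  assumes A: "psd_form n A"
  shows "(cmod (sform n A x y))\<^sup>2 \<le> Re (sform n A x x) * Re (sform n A y y)"
proof -
  define a b c where "a = Re (sform n A x x)" and "b = Re (sform n A y y)" and "c = sform n A x y"
  have ab: "sform n A x x = of_real a" "sform n A y y = of_real b" "sform n A y x = cnj c"
    using psd_form_eq_Re[OF A] psd_form_hermitian[OF A] unfolding a_def b_def c_def by blast+
  have nn: "0 \<le> a" "0 \<le> b" using psd_form_Re_nonneg[OF A] by (auto simp: a_def b_def)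
  have expand: "sform n A (\<lambda>i. p * x i + q * y i) (\<lambda>i. p * x i + q * y i)
      = cnj p * p * of_real a + cnj p * q * c + cnj q * p * cnj c + cnj q * q * of_real b" for p q
    by (simp add: sform_linear ab c_def[symmetric] algebra_simps)
  have q: "0 \<le> s\<^sup>2 * a + t\<^sup>2 * b * (cmod c)\<^sup>2 - 2 * s * t * (cmod c)\<^sup>2" for s t :: real
    using psd_form_Re_nonneg[OF A,
        of "\<lambda>i. complex_of_real s * x i + (- cnj c * complex_of_real t) * y i"]
    unfolding expand cmod_power2 by (simp add: algebra_simps power2_eq_square)
  show ?thesis
  proof (cases "b = 0")
    case True
    have "cmod c = 0"
    proof (rule ccontr)
      assume "cmod c \<noteq> 0"
      then have "0 < (cmod c)\<^sup>2" by simp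
      \<comment> \<open>For \<open>b = 0\<close> the bound is affine in \<open>t\<close>, and this
        \<open>t\<close> turns its right-hand side into \<open>- a - 2\<close>.\<close>
      with q[of 1 "(a + 1) / (cmod c)\<^sup>2"] True
      have "a * (cmod c)\<^sup>2 + 2 * (cmod c)\<^sup>2 \<le> 0" by (simp add: field_simps)
      moreover have "0 \<le> a * (cmod c)\<^sup>2" using nn by simp
      ultimately show False using \<open>0 < (cmod c)\<^sup>2\<close> by linarith
    qed
    then show ?thesis using nn by (simp add: a_def[symmetric] b_def[symmetric] c_def[symmetric])
  next
    case False
    have "0 \<le> b * (b * a - (cmod c)\<^sup>2)" using q[of b 1] by (simp add: algebra_simps power2_eq_square)
    then have "0 \<le> b * a - (cmod c)\<^sup>2" using False nn by (simp add: zero_le_mult_iff)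
    then show ?thesis by (simp add: a_def[symmetric] b_def[symmetric] c_def[symmetric] mult.commute)
  qed
qed

lemma psd_form_null:
  assumes "psd_form n A" "sform n A y y = 0"
  shows "sform n A x y = 0" "sform n A y x = 0"
  using psd_form_cauchy_schwarz[OF assms(1), of x y] psd_form_hermitian[OF assms(1), of y x] assms(2)
  by auto

lemma sform_basis_right:
  assumes "l < n"
  shows "sform n A x (\<lambda>j. if j = l then 1 else 0) = (\<Sum>i<n. cnj (x i) * A i l)"
proof -
  have "sform n A x (\<lambda>j. if j = l then 1 else 0) = (\<Sum>i<n. \<Sum>j<n. if j = l then cnj (x i) * A i j else 0)"
    unfolding sform_def by (intro sum.cong refl) auto
  then show ?thesis using assms by simp
qed

lemma sform_basis:
  assumes "k < n" "l < n"
  shows "sform n A (\<lambda>i. if i = k then 1 else 0) (\<lambda>j. if j = l then 1 else 0) = A k l"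
proof -
  have "sform n A (\<lambda>i. if i = k then 1 else 0) (\<lambda>j. if j = l then 1 else 0)
    = (\<Sum>i<n. if i = k then A i l else 0)"
    unfolding sform_basis_right[OF assms(2)] by (intro sum.cong refl) auto
  then show ?thesis using assms by simp
qed

lemma psd_form_entry_cnj: "psd_form n A \<Longrightarrow> k < n \<Longrightarrow> l < n \<Longrightarrow> A l k = cnj (A k l)"
  using psd_form_hermitian[of n A "\<lambda>j. if j = l then 1 else 0" "\<lambda>i. if i = k then 1 else 0"]
  by (simp add: sform_basis)

lemma psd_form_diag: "psd_form n A \<Longrightarrow> k < n \<Longrightarrow> 0 \<le> A k k"
  using sform_basis[of k n k A] by (metis psd_form_def)

lemma psd_form_diag_zero:
  assumes "psd_form n A" "k < n" "l < n" "A k k = 0"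
  shows "A l k = 0"
  using psd_form_null(1)[OF assms(1), of "\<lambda>i. if i = k then 1 else 0" "\<lambda>i. if i = l then 1 else 0"]
  by (simp add: sform_basis assms)

section \<open>Cholesky elimination for positive semidefinite forms\<close>

lemma sform_rank_one_diff:
  "sform n (\<lambda>i j. A i j - u i * cnj (u j)) x x
    = sform n A x x - of_real ((cmod (\<Sum>i<n. cnj (x i) * u i))\<^sup>2)"
proof -
  have "sform n (\<lambda>i j. A i j - u i * cnj (u j)) x x
     = sform n A x x - (\<Sum>i<n. cnj (x i) * u i) * (\<Sum>j<n. x j * cnj (u j))"
    by (simp add: sform_def algebra_simps sum_subtractf sum_product)
  also have "(\<Sum>j<n. x j * cnj (u j)) = cnj (\<Sum>i<n. cnj (x i) * u i)" by simp
  finally show ?thesis unfolding complex_norm_square by simp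
qed

text \<open>Column \<open>k\<close> of a Cholesky factor. If \<open>A k k = 0\<close>, division by
  zero gives the zero vector, which is the right value: column \<open>k\<close> of a positive
  semidefinite form then vanishes.\<close>

definition pivot :: "(nat \<Rightarrow> nat \<Rightarrow> complex) \<Rightarrow> nat \<Rightarrow> nat \<Rightarrow> complex" where
  "pivot A k i = A i k / complex_of_real (sqrt (Re (A k k)))"

text \<open>Cauchy-Schwarz against the basis vector with index \<open>k\<close> bounds the
  subtracted square by the form itself. The second claim says that the subtraction clears row
  \<open>k\<close>.\<close>

lemma psd_form_pivot:
  assumes A: "psd_form n A" and k: "k < n"
  shows "psd_form n (\<lambda>i j. A i j - pivot A k i * cnj (pivot A k j))"
    and "j < n \<Longrightarrow> A k j = pivot A k k * cnj (pivot A k j)"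
proof -
  let ?e = "\<lambda>i. if i = k then 1 else 0 :: complex"
  have d: "0 \<le> Re (A k k)" "Im (A k k) = 0"
    using psd_form_diag[OF A k] by (auto simp: less_eq_complex_def)
  have "0 \<le> sform n (\<lambda>i j. A i j - pivot A k i * cnj (pivot A k j)) x x" for x
  proof -
    have "(\<Sum>i<n. cnj (x i) * pivot A k i) = sform n A x ?e / complex_of_real (sqrt (Re (A k k)))"
      by (simp add: sform_basis_right[OF k] pivot_def sum_divide_distrib)
    then have "(cmod (\<Sum>i<n. cnj (x i) * pivot A k i))\<^sup>2 = (cmod (sform n A x ?e))\<^sup>2 / Re (A k k)"
      using d by (simp add: norm_divide power_divide)
    also have "\<dots> \<le> Re (sform n A x x)"
      using psd_form_cauchy_schwarz[OF A, of x ?e] d psd_form_Re_nonneg[OF A, of x]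
      by (cases "Re (A k k) = 0") (auto simp: sform_basis[OF k k] divide_le_eq)
    finally show ?thesis unfolding sform_rank_one_diff
      using psd_form_eq_Re[OF A, of x] by (simp add: less_eq_complex_def complex_eq_iff)
  qed
  then show "psd_form n (\<lambda>i j. A i j - pivot A k i * cnj (pivot A k j))"
    by (simp add: psd_form_def)
  assume j: "j < n"
  show "A k j = pivot A k k * cnj (pivot A k j)"
  proof (cases "A k k = 0")
    case True
    then show ?thesis
      using psd_form_diag_zero[OF A k j] psd_form_entry_cnj[OF A j k] by (simp add: pivot_def)
  next
    case False
    then have "0 < Re (A k k)" using d by (simp add: complex_eq_iff less_le)
    moreover have "A k k = of_real (Re (A k k))" using d by (simp add: complex_eq_iff)
    moreover have "A k j = cnj (A j k)" by (rule psd_form_entry_cnj[OF A j k])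
    ultimately show ?thesis
      by (simp add: pivot_def) (metis (no_types, lifting) less_imp_le nonzero_mult_div_cancel_left of_real_eq_0_iff of_real_mult order_less_irrefl real_sqrt_mult_self abs_of_pos times_divide_eq_right mult.commute)
  qed
qed

text \<open>Partial Cholesky factorization with one pivot for each index in \<open>S\<close>: the
  remainder stays positive semidefinite and its rows in \<open>S\<close> are zero.\<close>

lemma psd_form_eliminate:
  assumes A: "psd_form n A" and S: "finite S" "S \<subseteq> {..<n}"
  shows "\<exists>u. psd_form n (\<lambda>i j. A i j - (\<Sum>k\<in>S. u k i * cnj (u k j))) \<and>
     (\<forall>k\<in>S. \<forall>j<n. A k j = (\<Sum>l\<in>S. u l k * cnj (u l j)))"
  using S
proof (induction S)
  case empty
  then show ?case using A by simp
next
  case (insert k S)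
  then obtain u where P: "psd_form n (\<lambda>i j. A i j - (\<Sum>k\<in>S. u k i * cnj (u k j)))"
    and z: "\<And>k j. k\<in>S \<Longrightarrow> j<n \<Longrightarrow> A k j = (\<Sum>l\<in>S. u l k * cnj (u l j))" by auto
  define R where "R = (\<lambda>i j. A i j - (\<Sum>k\<in>S. u k i * cnj (u k j)))"
  have R: "psd_form n R" using P by (simp add: R_def)
  have k: "k < n" using insert by simp
  define u' where "u' = u(k := pivot R k)"
  have sum: "(\<Sum>l\<in>insert k S. u' l i * cnj (u' l j)) = pivot R k i * cnj (pivot R k j) + (\<Sum>l\<in>S. u l i * cnj (u l j))" for i j
    using insert.hyps by (auto simp: u'_def intro!: sum.cong)
  have "A m j = (\<Sum>l\<in>insert k S. u' l m * cnj (u' l j))" if "m \<in> insert k S" "j < n" for m j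
  proof (cases "m = k")
    case True
    have "A k j = R k j + (\<Sum>l\<in>S. u l k * cnj (u l j))" by (simp add: R_def)
    then show ?thesis
      unfolding True sum[of k j] psd_form_pivot(2)[OF R k \<open>j < n\<close>] .
  next
    case False
    with that have m: "m \<in> S" by simp
    \<comment> \<open>Row \<open>m\<close> has been cleared before, so the new pivot vector vanishes
      at \<open>m\<close> and does not disturb that row.\<close>
    have "R m k = 0" using z[OF m k] by (simp add: R_def)
    then show ?thesis using z[OF m \<open>j < n\<close>] sum[of m j] by (simp add: pivot_def)
  qed
  moreover have "psd_form n (\<lambda>i j. A i j - (\<Sum>l\<in>insert k S. u' l i * cnj (u' l j)))"
    using psd_form_pivot(1)[OF R k] unfolding sum by (simp add: R_def algebra_simps)
  ultimately show ?case by blast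
qed

lemma psd_form_decompose:
  assumes "psd_form n A"
  obtains u where "\<And>i j. i < n \<Longrightarrow> j < n \<Longrightarrow> A i j = (\<Sum>k<n. u k i * cnj (u k j))"
  using psd_form_eliminate[OF assms, of "{..<n}"] by auto

section \<open>Choi matrices\<close>

lemma sum_lessThan_mult:
  fixes g :: "nat \<Rightarrow> 'a :: comm_monoid_add"
  shows "(\<Sum>r<n * m. g r) = (\<Sum>i<n. \<Sum>k<m. g (i * m + k))"
proof (induction n)
  case (Suc n)
  have "(\<Sum>r<Suc n * m. g r) = (\<Sum>r<n * m. g r) + (\<Sum>k<m. g (n * m + k))"
    using sum.atLeastLessThan_concat[of 0 "n * m" "Suc n * m" g]
      sum.shift_bounds_nat_ivl[of g 0 "n * m" m]
    by (simp add: lessThan_atLeast0 add.commute)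
  then show ?case using Suc by simp
qed simp

lemma index_less_mult:
  assumes "i < n" "k < m"
  shows "i * m + k < n * (m::nat)"
proof -
  have "i * m + k < Suc i * m" using assms by simp
  also have "\<dots> \<le> n * m" using assms by (intro mult_le_mono1) simp
  finally show ?thesis .
qed

lemma sform_mult:
  "sform (n * m) A x y = (\<Sum>i<n. \<Sum>k<m. \<Sum>j<n. \<Sum>l<m.
     cnj (x (i * m + k)) * A (i * m + k) (j * m + l) * y (j * m + l))"
  unfolding sform_def sum_lessThan_mult ..

text \<open>The output index is the major digit and the input index the minor one, as in \<Phi>
  \<otimes> id applied to a maximally entangled vector. Rows with the same \<open>r div n\<close>
  lie over the same output basis vector.\<close>

definition choi :: "nat \<Rightarrow> (complex mat \<Rightarrow> complex mat) \<Rightarrow> nat \<Rightarrow> nat \<Rightarrow> complex" where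
  "choi n \<Phi> r s = \<Phi> (unit_op n (r mod n) (s mod n)) $$ (r div n, s div n)"

lemma choi_index:
  "i < n \<Longrightarrow> j < n \<Longrightarrow> choi n \<Phi> (r * n + i) (s * n + j) = \<Phi> (unit_op n i j) $$ (r, s)"
  by (simp add: choi_def)

lemma unit_op_carrier [simp]: "unit_op n i j \<in> carrier_mat n n"
  by (simp add: unit_op_def)

lemma linear_map_carrier: "linear_map n \<Phi> \<Longrightarrow> X \<in> carrier_mat n n \<Longrightarrow> \<Phi> X \<in> carrier_mat n n"
  by (simp add: linear_map_def)

lemma linear_map_dim_unit_op:
  assumes "linear_map n \<Phi>"
  shows "dim_row (\<Phi> (unit_op n i j)) = n" "dim_col (\<Phi> (unit_op n i j)) = n"
  using linear_map_carrier[OF assms unit_op_carrier] by auto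

lemma tensor_map_carrier [simp]: "tensor_map n m \<Phi> \<Psi> X \<in> carrier_mat (n * m) (n * m)"
  by (simp add: tensor_map_def)

lemma tensor_map_index:
  assumes \<Phi>: "linear_map n \<Phi>" and \<Psi>: "linear_map m \<Psi>"
    and "r < n" "s < n" "p < m" "q < m"
  shows "tensor_map n m \<Phi> \<Psi> X $$ (r * m + p, s * m + q) =
    (\<Sum>i<n. \<Sum>j<n. \<Sum>k<m. \<Sum>l<m. X $$ (i * m + k, j * m + l) *
       (\<Phi> (unit_op n i j) $$ (r, s) * \<Psi> (unit_op m k l) $$ (p, q)))"
  using assms index_less_mult[of r n p m] index_less_mult[of s n q m]
  by (simp add: tensor_map_def kron_def linear_map_dim_unit_op)

lemma linear_map_id: "linear_map n (\<lambda>Y. Y)"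
  by (simp add: linear_map_def)

lemma tensor_map_id_index:
  assumes \<Phi>: "linear_map n \<Phi>" and "r < n" "s < n" "p < m" "q < m"
  shows "tensor_map n m \<Phi> (\<lambda>Y. Y) X $$ (r * m + p, s * m + q) =
    (\<Sum>i<n. \<Sum>j<n. X $$ (i * m + p, j * m + q) * \<Phi> (unit_op n i j) $$ (r, s))"
proof -
  have "(\<Sum>k<m. \<Sum>l<m. X $$ (i * m + k, j * m + l) * (c * unit_op m k l $$ (p, q)))
    = X $$ (i * m + p, j * m + q) * c" for i j c
  proof -
    have "(\<Sum>k<m. \<Sum>l<m. X $$ (i * m + k, j * m + l) * (c * unit_op m k l $$ (p, q)))
      = (\<Sum>k<m. \<Sum>l<m. if l = q then (if k = p then X $$ (i * m + k, j * m + l) * c else 0) else 0)"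
      using assms by (intro sum.cong refl) (auto simp: unit_op_def)
    also have "\<dots> = X $$ (i * m + p, j * m + q) * c" using assms by simp
    finally show ?thesis .
  qed
  then show ?thesis
    unfolding tensor_map_index[OF \<Phi> linear_map_id assms(2-)] by simp
qed

lemma psd_form_rank_one: "psd_form n (\<lambda>i j. u i * cnj (u j))"
proof -
  have "sform n (\<lambda>i j. u i * cnj (u j)) x x = of_real ((cmod (\<Sum>i<n. cnj (x i) * u i))\<^sup>2)" for x
    using sform_rank_one_diff[of n "\<lambda>i j. 0" "\<lambda>i. u i" x]
    by (simp add: sform_def sum_negf)
  then show ?thesis by (simp add: psd_form_def less_eq_complex_def)
qed

text \<open>The Choi matrix is the image under \<Phi> \<otimes> id, with an ancilla of dimension
  \<open>n\<close>, of an unnormalised maximally entangled projector.\<close>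

lemma psd_form_choi:
  assumes \<Phi>: "linear_map n \<Phi>" and "completely_positive n \<Phi>"
  shows "psd_form (n * n) (choi n \<Phi>)"
proof -
  \<comment> \<open>This is the sum of all \<open>e\<^sub>i \<otimes> e\<^sub>i\<close>: its entry
    is 1 exactly where the two digits of the index agree.\<close>
  define e :: "nat \<Rightarrow> complex" where "e r = (if r div n = r mod n then 1 else 0)" for r
  define X where "X = mat (n * n) (n * n) (\<lambda>(r, s). e r * cnj (e s))"
  have "psd_form (n * n) (\<lambda>i j. X $$ (i, j))"
    using psd_form_rank_one[of "n * n" e]
    by (subst psd_form_cong[where B = "\<lambda>i j. e i * cnj (e j)"]) (auto simp: X_def)
  then have "psd (n * n) X" by (simp add: psd_iff_psd_form X_def)
  then have "psd (n * n) (tensor_map n n \<Phi> (\<lambda>Y. Y) X)"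
    using assms by (simp add: completely_positive_def)
  then have P: "psd_form (n * n) (\<lambda>i j. tensor_map n n \<Phi> (\<lambda>Y. Y) X $$ (i, j))"
    by (simp add: psd_iff_psd_form)
  have "tensor_map n n \<Phi> (\<lambda>Y. Y) X $$ (i, j) = choi n \<Phi> i j" if ij: "i < n * n" "j < n * n" for i j
  proof -
    have n: "0 < n" using ij by (cases n) auto
    have lt: "i div n < n" "i mod n < n" "j div n < n" "j mod n < n"
      using ij n by (auto simp: less_mult_imp_div_less)
    have "tensor_map n n \<Phi> (\<lambda>Y. Y) X $$ (i div n * n + i mod n, j div n * n + j mod n)
      = (\<Sum>k<n. \<Sum>l<n. X $$ (k * n + i mod n, l * n + j mod n) * \<Phi> (unit_op n k l) $$ (i div n, j div n))"
      by (rule tensor_map_id_index[OF \<Phi>]) (use lt in auto)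
    also have "\<dots> = (\<Sum>k<n. \<Sum>l<n. if l = j mod n then (if k = i mod n then
        \<Phi> (unit_op n k l) $$ (i div n, j div n) else 0) else 0)"
      using lt by (intro sum.cong refl) (auto simp: X_def e_def index_less_mult)
    also have "\<dots> = choi n \<Phi> i j" using lt by (simp add: choi_def)
    finally show ?thesis by simp
  qed
  then show ?thesis
    using P psd_form_cong[of "n * n" "\<lambda>i j. tensor_map n n \<Phi> (\<lambda>Y. Y) X $$ (i, j)" "choi n \<Phi>"]
    by simp
qed

text \<open>For \<open>X = x x\<^sup>*\<close> the form of \<open>(\<Phi> \<otimes> id) X\<close> is the form of the Choi matrix at the contraction
  of \<open>v\<close> with \<open>x\<close> over the ancilla; the general case follows by decomposing \<open>X\<close>.\<close>

lemma completely_positive_if_psd_form_choi: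
  assumes \<Phi>: "linear_map n \<Phi>" and C: "psd_form (n * n) (choi n \<Phi>)"
  shows "completely_positive n \<Phi>"
  unfolding completely_positive_def
proof (intro allI impI)
  fix d X assume "psd (n * d) X"
  then have "psd_form (n * d) (\<lambda>i j. X $$ (i, j))" by (simp add: psd_iff_psd_form)
  from psd_form_decompose[OF this] obtain u
    where u: "\<And>i j. i < n * d \<Longrightarrow> j < n * d \<Longrightarrow> X $$ (i, j) = (\<Sum>k<n * d. u k i * cnj (u k j))"
    by blast
  have "0 \<le> sform (n * d) (\<lambda>i j. tensor_map n d \<Phi> (\<lambda>Y. Y) X $$ (i, j)) v v" for v
  proof -
    define z where "z k r = (\<Sum>a<d. v (r div n * d + a) * cnj (u k (r mod n * d + a)))" for k r
    have "sform (n * d) (\<lambda>i j. tensor_map n d \<Phi> (\<lambda>Y. Y) X $$ (i, j)) v v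
      = (\<Sum>r<n. \<Sum>a<d. \<Sum>s<n. \<Sum>b<d. \<Sum>i<n. \<Sum>j<n. \<Sum>k<n * d.
          cnj (v (r * d + a)) * (u k (i * d + a) * cnj (u k (j * d + b))) *
          \<Phi> (unit_op n i j) $$ (r, s) * v (s * d + b))"
      unfolding sform_mult
      by (intro sum.cong refl)
        (simp add: tensor_map_id_index[OF \<Phi>] u index_less_mult sum_distrib_left sum_distrib_right
          mult.assoc)
    also have "\<dots> = (\<Sum>k<n * d. \<Sum>r<n. \<Sum>i<n. \<Sum>s<n. \<Sum>j<n. \<Sum>a<d. \<Sum>b<d.
          cnj (v (r * d + a)) * (u k (i * d + a) * cnj (u k (j * d + b))) *
          \<Phi> (unit_op n i j) $$ (r, s) * v (s * d + b))"
      unfolding sum.swap[where B = "{..<n * d}"]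
        sum.swap[where A = "{..<d}" and B = "{..<n}"]
      by (rule sum.cong[OF refl], rule sum.cong[OF refl], rule sum.swap)
    also have "\<dots> = (\<Sum>k<n * d. sform (n * n) (choi n \<Phi>) (z k) (z k))"
    proof -
      have contract: "cnj (z k (r * n + i)) * choi n \<Phi> (r * n + i) (s * n + j) * z k (s * n + j)
        = (\<Sum>a<d. \<Sum>b<d. cnj (v (r * d + a)) * (u k (i * d + a) * cnj (u k (j * d + b))) *
            \<Phi> (unit_op n i j) $$ (r, s) * v (s * d + b))" if "i < n" "j < n" for k r i s j
      proof -
        let ?c = "\<Phi> (unit_op n i j) $$ (r, s)"
        have "cnj (z k (r * n + i)) * ?c = (\<Sum>a<d. cnj (v (r * d + a)) * u k (i * d + a) * ?c)"
          using that by (simp add: z_def sum_distrib_right)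
        moreover have "z k (s * n + j) = (\<Sum>b<d. v (s * d + b) * cnj (u k (j * d + b)))"
          using that by (simp add: z_def)
        ultimately have "cnj (z k (r * n + i)) * ?c * z k (s * n + j) =
            (\<Sum>a<d. \<Sum>b<d. (cnj (v (r * d + a)) * u k (i * d + a) * ?c) *
               (v (s * d + b) * cnj (u k (j * d + b))))"
          by (simp only: sum_product)
        then show ?thesis unfolding choi_index[OF that] by (simp only: mult_ac)
      qed
      show ?thesis
        unfolding sform_mult
        by (intro sum.cong refl) (rule contract[symmetric], simp_all)
    qed
    also have "0 \<le> \<dots>" using C by (intro sum_nonneg) (simp add: psd_form_def)
    finally show ?thesis .
  qed
  then show "psd (n * d) (tensor_map n d \<Phi> (\<lambda>Y. Y) X)"
    by (simp add: psd_iff_psd_form psd_form_def)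
qed

section \<open>Trace preservation and the inverse of the Choi correspondence\<close>

lemma trace_preserving_unit_op:
  assumes "linear_map n \<Phi>" "trace_preserving n \<Phi>" "i < n" "j < n"
  shows "(\<Sum>r<n. \<Phi> (unit_op n i j) $$ (r, r)) = (if i = j then 1 else 0)"
proof -
  have "mtrace (\<Phi> (unit_op n i j)) = mtrace (unit_op n i j)"
    using assms by (simp add: trace_preserving_def)
  also have "\<dots> = (\<Sum>r<n. if r = i then (if r = j then 1 else 0) else 0)"
    unfolding mtrace_def by (intro sum.cong) (auto simp: unit_op_def)
  finally show ?thesis using assms by (simp add: mtrace_def linear_map_dim_unit_op)
qed

text \<open>The inverse of \<open>choi\<close> on linear maps. It allows a channel to be perturbed
  through its Choi matrix.\<close>

definition map_of_choi :: "nat \<Rightarrow> (nat \<Rightarrow> nat \<Rightarrow> complex) \<Rightarrow> complex mat \<Rightarrow> complex mat" where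
  "map_of_choi n C X = mat n n (\<lambda>(r, s). \<Sum>i<n. \<Sum>j<n. X $$ (i, j) * C (r * n + i) (s * n + j))"

lemma linear_map_of_choi: "linear_map n (map_of_choi n C)"
  unfolding linear_map_def
  by (auto simp: map_of_choi_def intro!: eq_matI)
    (simp_all add: distrib_right mult.assoc sum.distrib sum_distrib_left)

lemma map_of_choi_unit_op:
  assumes "i < n" "j < n" "r < n" "s < n"
  shows "map_of_choi n C (unit_op n i j) $$ (r, s) = C (r * n + i) (s * n + j)"
proof -
  have "map_of_choi n C (unit_op n i j) $$ (r, s)
    = (\<Sum>k<n. \<Sum>l<n. unit_op n i j $$ (k, l) * C (r * n + k) (s * n + l))"
    using assms by (simp add: map_of_choi_def)
  also have "\<dots>
    = (\<Sum>k<n. \<Sum>l<n. if l = j then (if k = i then C (r * n + k) (s * n + l) else 0) else 0)"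
    by (intro sum.cong refl) (auto simp: unit_op_def)
  finally show ?thesis using assms by simp
qed

lemma choi_map_of_choi:
  assumes "r < n * n" "s < n * n"
  shows "choi n (map_of_choi n C) r s = C r s"
proof -
  have "0 < n" using assms by (cases n) auto
  then show ?thesis
    using assms by (simp add: choi_def map_of_choi_unit_op less_mult_imp_div_less)
qed

lemma map_of_choi_choi:
  assumes "linear_map n \<Phi>" "X \<in> carrier_mat n n"
  shows "map_of_choi n (choi n \<Phi>) X = \<Phi> X"
  using linear_map_carrier[OF assms] assms
  by (intro eq_matI) (auto simp: map_of_choi_def linear_map_expand[OF assms] choi_index)

text \<open>Positivity of \<open>C\<close> gives complete positivity, and \<open>tp\<close> says
  that the partial trace of \<open>C\<close> over the output is the identity, which is trace
  preservation on the matrix units.\<close>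

lemma channel_map_of_choi:
  assumes C: "psd_form (n * n) C"
    and tp: "\<And>i j. i < n \<Longrightarrow> j < n \<Longrightarrow> (\<Sum>r<n. C (r * n + i) (r * n + j)) = (if i = j then 1 else 0)"
  shows "channel n (map_of_choi n C)"
  unfolding channel_def
proof (intro conjI)
  show L: "linear_map n (map_of_choi n C)" by (rule linear_map_of_choi)
  have "psd_form (n * n) (choi n (map_of_choi n C))"
    using C by (subst psd_form_cong[where B = C]) (auto simp: choi_map_of_choi)
  then show "completely_positive n (map_of_choi n C)"
    by (rule completely_positive_if_psd_form_choi[OF L])
  show "trace_preserving n (map_of_choi n C)"
    unfolding trace_preserving_def
  proof
    fix X :: "complex mat" assume X: "X \<in> carrier_mat n n"
    have "mtrace (map_of_choi n C X) = (\<Sum>r<n. \<Sum>i<n. \<Sum>j<n. X $$ (i, j) * C (r * n + i) (r * n + j))"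
      by (simp add: mtrace_def map_of_choi_def)
    also have "\<dots> = (\<Sum>i<n. \<Sum>j<n. X $$ (i, j) * (\<Sum>r<n. C (r * n + i) (r * n + j)))"
      unfolding sum_distrib_left
      by (rule trans[OF sum.swap], rule sum.cong[OF refl], rule sum.swap)
    also have "\<dots> = (\<Sum>i<n. \<Sum>j<n. if j = i then X $$ (i, j) else 0)"
      by (intro sum.cong refl) (auto simp: tp)
    also have "\<dots> = mtrace X" using X by (simp add: mtrace_def)
    finally show "mtrace (map_of_choi n C X) = mtrace X" .
  qed
qed

section \<open>Extremal qubit channels\<close>

lemma sum_lessThan_two: "(\<Sum>i<2. h i) = h 0 + h (1::nat)"
  by (simp add: numeral_2_eq_2)

lemma sum_lessThan_four: "(\<Sum>i<2 * 2. h i) = h 0 + h 1 + h 2 + h (3::nat)"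
  by (simp add: eval_nat_numeral)

lemma sform_add_form: "sform n (\<lambda>i j. A i j + B i j) x y = sform n A x y + sform n B x y"
  by (simp add: sform_def algebra_simps sum.distrib)

lemma sform_scale_form: "sform n (\<lambda>i j. c * A i j) x y = c * sform n A x y"
  by (simp add: sform_def algebra_simps sum_distrib_left)

lemma sform_sum_form:
  "sform n (\<lambda>i j. \<Sum>k\<in>S. A k i j) x y = (\<Sum>k\<in>S. sform n (A k) x y)"
  by (induction S rule: infinite_finite_induct) (simp_all add: sform_add_form, simp_all add: sform_def)

lemma sform_rank_one:
  "sform n (\<lambda>i j. u i * cnj (w j)) x y = (\<Sum>i<n. cnj (x i) * u i) * cnj (\<Sum>j<n. cnj (y j) * w j)"
  by (simp add: sform_def sum_product mult_ac)

text \<open>Eliminate the rows in \<open>S\<close>. If the remainder \<open>R\<close> is zero,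
  \<open>A\<close> has rank at most the size of \<open>S\<close>; otherwise a pivot column of
  \<open>R\<close> is a nonzero \<open>g\<close> that vanishes on \<open>S\<close> and satisfies
  \<open>g g\<^sup>* \<le> A\<close> as forms.\<close>

lemma psd_form_complement_dichotomy:
  assumes A: "psd_form n A" and S: "S \<subseteq> {..<n}"
  obtains (low_rank) u where
    "\<And>i j. i < n \<Longrightarrow> j < n \<Longrightarrow> A i j = (\<Sum>k\<in>S. u k i * cnj (u k j))"
  | (minorant) g k where "\<And>x. (cmod (\<Sum>i<n. cnj (x i) * g i))\<^sup>2 \<le> Re (sform n A x x)"
    "\<And>i. i \<in> S \<Longrightarrow> g i = 0" "k < n" "g k \<noteq> 0"
proof -
  from psd_form_eliminate[OF A finite_subset[OF S] S] obtain u
    where P: "psd_form n (\<lambda>i j. A i j - (\<Sum>k\<in>S. u k i * cnj (u k j)))"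
      and z: "\<And>k j. k \<in> S \<Longrightarrow> j < n \<Longrightarrow> A k j = (\<Sum>l\<in>S. u l k * cnj (u l j))" by auto
  define R where "R = (\<lambda>i j. A i j - (\<Sum>k\<in>S. u k i * cnj (u k j)))"
  have R: "psd_form n R" using P by (simp add: R_def)
  show thesis
  proof (cases "\<forall>k<n. R k k = 0")
    case True
    then have "R i j = 0" if "i < n" "j < n" for i j
      using psd_form_diag_zero[OF R] that by blast
    then show thesis by (intro low_rank[of u]) (simp add: R_def)
  next
    case False
    then obtain k where k: "k < n" "R k k \<noteq> 0" by blast
    have "(cmod (\<Sum>i<n. cnj (x i) * pivot R k i))\<^sup>2 \<le> Re (sform n A x x)" for x
    proof -
      \<comment> \<open>\<open>R\<close> dominates the square of its pivot column, and
        \<open>A\<close> dominates \<open>R\<close> since the eliminated part is a sum of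
        squares.\<close>
      have "(cmod (\<Sum>i<n. cnj (x i) * pivot R k i))\<^sup>2 \<le> Re (sform n R x x)"
        using psd_form_Re_nonneg[OF psd_form_pivot(1)[OF R k(1)], of x]
        unfolding sform_rank_one_diff by simp
      moreover have "A = (\<lambda>i j. R i j + (\<Sum>k\<in>S. u k i * cnj (u k j)))"
        by (simp add: R_def)
      then have "sform n A x x = sform n R x x + (\<Sum>k\<in>S. sform n (\<lambda>i j. u k i * cnj (u k j)) x x)"
        by (simp only: sform_add_form sform_sum_form)
      moreover have "0 \<le> Re (\<Sum>k\<in>S. sform n (\<lambda>i j. u k i * cnj (u k j)) x x)"
        by (simp add: sum_nonneg psd_form_Re_nonneg psd_form_rank_one)
      ultimately show ?thesis by simp
    qed
    moreover have "pivot R k i = 0" if "i \<in> S" for i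
      using z[OF that k(1)] by (simp add: pivot_def R_def)
    moreover have "pivot R k k \<noteq> 0"
      using psd_form_diag[OF R k(1)] k(2)
      by (auto simp: pivot_def less_eq_complex_def complex_eq_iff)
    ultimately show thesis using k(1) by (intro minorant)
  qed
qed

lemma extremal_channel_channel: "extremal_channel n \<Phi> \<Longrightarrow> channel n \<Phi>"
  unfolding extremal_channel_def by (rule conjunct1)

text \<open>Perturbing the Choi matrix by \<open>\<plusminus>(f g\<^sup>* + g f\<^sup>*) / 2\<close> keeps it positive semidefinite, and it
  keeps the trace condition since the supports of \<open>f\<close> and \<open>g\<close> lie over different outputs.\<close>

lemma extremal_channel_minorants:
  assumes ext: "extremal_channel 2 \<Phi>"
    and f: "\<And>x. (cmod (\<Sum>i<2 * 2. cnj (x i) * f i))\<^sup>2 \<le> Re (sform (2 * 2) (choi 2 \<Phi>) x x)"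
      "f 2 = 0" "f 3 = 0"
    and g: "\<And>x. (cmod (\<Sum>i<2 * 2. cnj (x i) * g i))\<^sup>2 \<le> Re (sform (2 * 2) (choi 2 \<Phi>) x x)"
      "g 0 = 0" "g 1 = 0"
    and ij: "i < 2" "j < 2"
  shows "f i = 0 \<or> g (2 + j) = 0"
proof -
  have L: "linear_map 2 \<Phi>" and cp: "completely_positive 2 \<Phi>" and tp: "trace_preserving 2 \<Phi>"
    using extremal_channel_channel[OF ext] by (simp_all add: channel_def)
  define D :: "real \<Rightarrow> nat \<Rightarrow> nat \<Rightarrow> complex" where
    "D c i j = choi 2 \<Phi> i j + of_real (c / 2) * (f i * cnj (g j) + g i * cnj (f j))" for c i j
  have ch: "channel 2 (map_of_choi 2 (D c))" if c: "c\<^sup>2 = 1" for c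
  proof (rule channel_map_of_choi)
    have "0 \<le> sform (2 * 2) (D c) x x" for x
    proof -
      define F G where "F = (\<Sum>i<2 * 2. cnj (x i) * f i)" and "G = (\<Sum>i<2 * 2. cnj (x i) * g i)"
      have eq: "sform (2 * 2) (D c) x x
          = sform (2 * 2) (choi 2 \<Phi>) x x + of_real (c / 2) * (F * cnj G + G * cnj F)"
        unfolding D_def sform_add_form sform_scale_form sform_rank_one F_def G_def ..
      have *: "F * cnj G + G * cnj F = of_real (2 * Re (F * cnj G))"
        by (simp add: complex_eq_iff)
      have "Re (sform (2 * 2) (D c) x x) = Re (sform (2 * 2) (choi 2 \<Phi>) x x) + c * Re (F * cnj G)"
        unfolding eq * by simp
      \<comment> \<open>As \<open>c\<^sup>2 = 1\<close>, this square bounds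
        \<open>c * Re (F * cnj G)\<close> below by minus the mean of \<open>|F|\<^sup>2\<close> and
        \<open>|G|\<^sup>2\<close>, and both are at most the Choi form. This fixes the factor 1/2 in
        the perturbation.\<close>
      moreover have "(cmod (F + of_real c * G))\<^sup>2 = (cmod F)\<^sup>2 + c\<^sup>2 * (cmod G)\<^sup>2 + 2 * c * Re (F * cnj G)"
        unfolding cmod_power2 by (simp add: power2_eq_square algebra_simps)
      moreover have "0 \<le> (cmod (F + of_real c * G))\<^sup>2" by simp
      ultimately have "0 \<le> Re (sform (2 * 2) (D c) x x)"
        using f(1)[of x] g(1)[of x] unfolding F_def[symmetric] G_def[symmetric] c by simp
      moreover have "Im (sform (2 * 2) (D c) x x) = 0"
        using psd_form_eq_Re[OF psd_form_choi[OF L cp], of x]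
        unfolding eq * by (simp add: complex_eq_iff)
      ultimately show ?thesis by (simp add: less_eq_complex_def)
    qed
    then show "psd_form (2 * 2) (D c)" by (simp add: psd_form_def)
    fix i j :: nat assume "i < 2" "j < 2"
    then have "(\<Sum>r<2. choi 2 \<Phi> (r * 2 + i) (r * 2 + j)) = (if i = j then 1 else 0)"
      using trace_preserving_unit_op[OF L tp, of i j] by (simp add: choi_index)
    moreover have "i = 0 \<or> i = 1" "j = 0 \<or> j = 1" using \<open>i < 2\<close> \<open>j < 2\<close> by auto
    then have zero: "f (r * 2 + i) * cnj (g (r * 2 + j)) + g (r * 2 + i) * cnj (f (r * 2 + j)) = 0"
      if "r = 0 \<or> r = 1" for r
      using that f(2,3) g(2,3) by auto
    have "D c (r * 2 + i) (r * 2 + j) = choi 2 \<Phi> (r * 2 + i) (r * 2 + j)" if "r < 2" for r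
      unfolding D_def using zero[of r] that by (simp add: less_2_cases_iff)
    then have "(\<Sum>r<2. D c (r * 2 + i) (r * 2 + j)) = (\<Sum>r<2. choi 2 \<Phi> (r * 2 + i) (r * 2 + j))"
      by (intro sum.cong) simp_all
    ultimately show "(\<Sum>r<2. D c (r * 2 + i) (r * 2 + j)) = (if i = j then 1 else 0)"
      by (simp only:)
  qed
  have avg: "\<Phi> X = of_real (1/2) \<cdot>\<^sub>m map_of_choi 2 (D 1) X + of_real (1 - 1/2) \<cdot>\<^sub>m map_of_choi 2 (D (-1)) X"
    if X: "X \<in> carrier_mat 2 2" for X
    unfolding map_of_choi_choi[OF L X, symmetric]
    by (intro eq_matI)
      (auto simp: map_of_choi_def D_def sum_distrib_left sum.distrib[symmetric] algebra_simps
        intro!: sum.cong)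
  have "\<forall>X\<in>carrier_mat 2 2. map_of_choi 2 (D 1) X = \<Phi> X \<and> map_of_choi 2 (D (-1)) X = \<Phi> X"
    by (rule ext[unfolded extremal_channel_def, THEN conjunct2, THEN spec, THEN spec, THEN spec,
          of "map_of_choi 2 (D 1)" "map_of_choi 2 (D (-1))" "1/2", THEN mp])
      (intro conjI ballI ch avg; simp)
  then have "map_of_choi 2 (D 1) X = \<Phi> X" if "X \<in> carrier_mat 2 2" for X
    using that by blast
  \<comment> \<open>The output entry (0, 1) at the input unit \<open>(i, j)\<close> is the Choi
    entry \<open>(i, 2 + j)\<close>. Since \<open>g i = 0\<close>, the perturbation there is half of
    \<open>f i * cnj (g (2 + j))\<close>.\<close>
  from arg_cong[OF this[of "unit_op 2 i j"], of "\<lambda>Y. Y $$ (0, 1)"]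
  have "D 1 (0 * 2 + i) (1 * 2 + j) = choi 2 \<Phi> (0 * 2 + i) (1 * 2 + j)"
    using map_of_choi_unit_op[of i 2 j 0 1 "D 1"] choi_index[of i 2 j \<Phi> 0 1] ij by simp
  moreover have "g i = 0" using g ij by (cases i) auto
  ultimately show ?thesis by (simp add: D_def)
qed

section \<open>Product vectors in the null space of a Choi matrix of rank at most two\<close>

lemma binary_quadratic_form_root:
  fixes a b c :: complex
  obtains p q where "p \<noteq> 0 \<or> q \<noteq> 0" "a * p\<^sup>2 + b * p * q + c * q\<^sup>2 = 0"
proof (cases "a = 0")
  case True
  then show ?thesis using that[of 1 0] by simp
next
  case False
  define s where "s = csqrt (b\<^sup>2 - 4 * a * c)"
  have s: "s\<^sup>2 = b\<^sup>2 - 4 * a * c" by (simp add: s_def)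
  define p where "p = (s - b) / (2 * a)"
  have ap: "2 * a * p = s - b" using False by (simp add: p_def)
  have "4 * a * (a * p\<^sup>2 + b * p * 1 + c * 1\<^sup>2) = (2 * a * p)\<^sup>2 + 2 * b * (2 * a * p) + 4 * a * c"
    by (simp add: power2_eq_square algebra_simps)
  also have "\<dots> = s\<^sup>2 - b\<^sup>2 + 4 * a * c" unfolding ap by (simp add: power2_eq_square algebra_simps)
  also have "\<dots> = 0" unfolding s by simp
  finally have "a * p\<^sup>2 + b * p * 1 + c * 1\<^sup>2 = 0" using False by simp
  then show ?thesis using that[of p 1] by simp
qed

lemma singular_system_solution:
  fixes a b c d :: complex
  assumes "a * d = b * c"
  obtains x y where "x \<noteq> 0 \<or> y \<noteq> 0" "a * x + b * y = 0" "c * x + d * y = 0"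
proof (cases "a = 0 \<and> b = 0")
  case False
  then show ?thesis using that[of b "-a"] assms by (auto simp: mult.commute)
next
  case True
  show ?thesis
  proof (cases "c = 0 \<and> d = 0")
    case False
    then show ?thesis using that[of d "-c"] True by auto
  next
    case True
    then show ?thesis using that[of 1 0] \<open>a = 0 \<and> b = 0\<close> by auto
  qed
qed

text \<open>For fixed \<open>p = (s, t)\<close> the two conditions are a 2 by 2 linear system for
  \<open>q\<close>. Its determinant is a binary quadratic form in \<open>s\<close> and
  \<open>t\<close>, which has a nontrivial complex zero; there the system is singular and
  \<open>q\<close> exists.\<close>

lemma rank_two_product_null_vector:
  fixes u w :: "nat \<Rightarrow> complex"
  obtains p q :: "nat \<Rightarrow> complex"
  where "p 0 \<noteq> 0 \<or> p 1 \<noteq> 0" "q 0 \<noteq> 0 \<or> q 1 \<noteq> 0"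
    "(\<Sum>r<2 * 2. p (r div 2) * q (r mod 2) * u r) = 0"
    "(\<Sum>r<2 * 2. p (r div 2) * q (r mod 2) * w r) = 0"
proof -
  obtain s t where st: "s \<noteq> 0 \<or> t \<noteq> 0"
    "(u 0 * w 1 - u 1 * w 0) * s\<^sup>2 + (u 0 * w 3 + u 2 * w 1 - u 1 * w 2 - u 3 * w 0) * s * t
      + (u 2 * w 3 - u 3 * w 2) * t\<^sup>2 = 0"
    by (rule binary_quadratic_form_root)
  then have "(s * u 0 + t * u 2) * (s * w 1 + t * w 3) = (s * u 1 + t * u 3) * (s * w 0 + t * w 2)"
    by (simp add: power2_eq_square algebra_simps)
  then obtain x y where "x \<noteq> 0 \<or> y \<noteq> 0"
    "(s * u 0 + t * u 2) * x + (s * u 1 + t * u 3) * y = 0"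
    "(s * w 0 + t * w 2) * x + (s * w 1 + t * w 3) * y = 0"
    by (rule singular_system_solution)
  with st show ?thesis
    by (intro that[of "\<lambda>i. if i = 0 then s else t" "\<lambda>i. if i = 0 then x else y"])
      (simp_all only: sum_lessThan_four, auto simp: algebra_simps)
qed

definition prod_vec :: "nat \<Rightarrow> (nat \<Rightarrow> complex) \<Rightarrow> (nat \<Rightarrow> complex) \<Rightarrow> nat \<Rightarrow> complex" where
  "prod_vec m a b r = a (r div m) * b (r mod m)"

text \<open>The index sets {0, 1} and {2, 3} are the Choi rows over the first and the second output.
  Minorants from both dichotomies would contradict \<open>extremal_channel_minorants\<close>, so one
  of them bounds the rank of the Choi matrix by two, and a product vector orthogonal to its two
  components exists.\<close>

lemma extremal_channel_null_vector:
  assumes ext: "extremal_channel 2 \<Phi>"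
  obtains p q :: "nat \<Rightarrow> complex"
  where "p 0 \<noteq> 0 \<or> p 1 \<noteq> 0" "q 0 \<noteq> 0 \<or> q 1 \<noteq> 0"
    "sform (2 * 2) (choi 2 \<Phi>) (prod_vec 2 p q) (prod_vec 2 p q) = 0"
proof -
  let ?C = "choi 2 \<Phi>"
  have C: "psd_form (2 * 2) ?C"
    using extremal_channel_channel[OF ext] by (intro psd_form_choi) (simp_all add: channel_def)
  have "\<exists>u w. \<forall>i<2 * 2. \<forall>j<2 * 2. ?C i j = u i * cnj (u j) + w i * cnj (w j)"
  proof (rule psd_form_complement_dichotomy[OF C, of "{0, 1}"])
    fix u :: "nat \<Rightarrow> nat \<Rightarrow> complex" assume "\<And>i j. i < 2 * 2 \<Longrightarrow> j < 2 * 2 \<Longrightarrow> ?C i j = (\<Sum>k\<in>{0, 1}. u k i * cnj (u k j))"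
    then have "\<forall>i<2 * 2. \<forall>j<2 * 2. ?C i j = u 0 i * cnj (u 0 j) + u 1 i * cnj (u 1 j)"
        by simp
      then show ?thesis by blast
  next
    fix g k assume g: "\<And>x. (cmod (\<Sum>i<2 * 2. cnj (x i) * g i))\<^sup>2 \<le> Re (sform (2 * 2) ?C x x)"
      "\<And>i. i \<in> {0, 1} \<Longrightarrow> g i = 0" "k < 2 * 2" "g k \<noteq> 0"
    show ?thesis
    proof (rule psd_form_complement_dichotomy[OF C, of "{2, 3}"])
      fix u :: "nat \<Rightarrow> nat \<Rightarrow> complex" assume "\<And>i j. i < 2 * 2 \<Longrightarrow> j < 2 * 2 \<Longrightarrow> ?C i j = (\<Sum>k\<in>{2, 3}. u k i * cnj (u k j))"
      then have "\<forall>i<2 * 2. \<forall>j<2 * 2. ?C i j = u 2 i * cnj (u 2 j) + u 3 i * cnj (u 3 j)"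
        by simp
      then show ?thesis by blast
    next
      fix f l assume f: "\<And>x. (cmod (\<Sum>i<2 * 2. cnj (x i) * f i))\<^sup>2 \<le> Re (sform (2 * 2) ?C x x)"
        "\<And>i. i \<in> {2, 3} \<Longrightarrow> f i = 0" "l < 2 * 2" "f l \<noteq> 0"
      have "2 \<le> k" using g(2)[of k] g(4) by (cases "k = 0 \<or> k = 1") auto
      then obtain j where "k = 2 + j" by (auto simp: le_iff_add)
      moreover have "l < 2"
      proof -
        have "l \<noteq> 2" "l \<noteq> 3" using f(2)[of l] f(4) by auto
        then show ?thesis using f(3) by simp
      qed
      ultimately show ?thesis
        using extremal_channel_minorants[OF ext f(1) _ _ g(1), of l j] f(2,4) g(2-4) by simp
    qed auto
  qed auto
  then obtain u w where uw: "\<And>i j. i < 2 * 2 \<Longrightarrow> j < 2 * 2 \<Longrightarrow> ?C i j = u i * cnj (u j) + w i * cnj (w j)"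
    by blast
  from rank_two_product_null_vector[of u w] obtain p q :: "nat \<Rightarrow> complex"
    where pq: "p 0 \<noteq> 0 \<or> p 1 \<noteq> 0" "q 0 \<noteq> 0 \<or> q 1 \<noteq> 0"
      "(\<Sum>r<2 * 2. p (r div 2) * q (r mod 2) * u r) = 0"
      "(\<Sum>r<2 * 2. p (r div 2) * q (r mod 2) * w r) = 0" by blast
  \<comment> \<open>\<open>rank_two_product_null_vector\<close> is bilinear, whereas the form
    conjugates its left argument; hence the conjugates.\<close>
  let ?z = "prod_vec 2 (\<lambda>i. cnj (p i)) (\<lambda>i. cnj (q i))"
  have "sform (2 * 2) ?C ?z ?z
      = sform (2 * 2) (\<lambda>i j. u i * cnj (u j) + w i * cnj (w j)) ?z ?z"
    using uw by (simp add: sform_def)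
  also have "\<dots> = 0" unfolding sform_add_form sform_rank_one using pq(3,4)
    by (simp add: prod_vec_def)
  finally show thesis using pq(1,2) that[of "\<lambda>i. cnj (p i)" "\<lambda>i. cnj (q i)"] by simp
qed

section \<open>Separable states\<close>

definition matrix_element ::
  "nat \<Rightarrow> (complex mat \<Rightarrow> complex mat) \<Rightarrow> (nat \<Rightarrow> complex) \<Rightarrow> (nat \<Rightarrow> complex) \<Rightarrow>
     (nat \<Rightarrow> complex) \<Rightarrow> (nat \<Rightarrow> complex) \<Rightarrow> complex" where
  "matrix_element n \<Phi> x y a b =
     (\<Sum>i<n. \<Sum>j<n. x i * cnj (y j) * sform n (\<lambda>r s. \<Phi> (unit_op n i j) $$ (r, s)) a b)"

text \<open>Makes Cauchy-Schwarz and the null vector argument for the Choi form available for matrix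
  elements. The inputs are conjugated because \<open>x\<close> enters linearly, whereas the left
  argument of the form is conjugate-linear.\<close>

lemma matrix_element_choi:
  "matrix_element n \<Phi> x y a b
    = sform (n * n) (choi n \<Phi>) (prod_vec n a (\<lambda>i. cnj (x i))) (prod_vec n b (\<lambda>i. cnj (y i)))"
proof -
  have "matrix_element n \<Phi> x y a b = (\<Sum>i<n. \<Sum>j<n. \<Sum>r<n. \<Sum>s<n.
      cnj (a r) * x i * \<Phi> (unit_op n i j) $$ (r, s) * (b s * cnj (y j)))"
    by (simp add: matrix_element_def sform_def sum_distrib_left mult_ac)
  also have "\<dots> = (\<Sum>i<n. \<Sum>r<n. \<Sum>j<n. \<Sum>s<n.
      cnj (a r) * x i * \<Phi> (unit_op n i j) $$ (r, s) * (b s * cnj (y j)))"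
    by (rule sum.cong[OF refl], rule sum.swap)
  also have "\<dots> = (\<Sum>r<n. \<Sum>i<n. \<Sum>j<n. \<Sum>s<n.
      cnj (a r) * x i * \<Phi> (unit_op n i j) $$ (r, s) * (b s * cnj (y j)))"
    by (rule sum.swap)
  also have "\<dots> = (\<Sum>r<n. \<Sum>i<n. \<Sum>s<n. \<Sum>j<n.
      cnj (a r) * x i * \<Phi> (unit_op n i j) $$ (r, s) * (b s * cnj (y j)))"
    by (rule sum.cong[OF refl], rule sum.cong[OF refl], rule sum.swap)
  also have "\<dots> = sform (n * n) (choi n \<Phi>) (prod_vec n a (\<lambda>i. cnj (x i))) (prod_vec n b (\<lambda>i. cnj (y i)))"
    unfolding sform_mult by (simp add: prod_vec_def choi_index)
  finally show ?thesis .
qed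

lemma kron_index:
  assumes "A \<in> carrier_mat n n" "B \<in> carrier_mat m m" "i < n" "j < n" "k < m" "l < m"
  shows "kron A B $$ (i * m + k, j * m + l) = A $$ (i, j) * B $$ (k, l)"
  using assms index_less_mult[of i n k m] index_less_mult[of j n l m] by (simp add: kron_def)

lemma sform_kron:
  assumes "A \<in> carrier_mat n n" "B \<in> carrier_mat m m"
  shows "sform (n * m) (\<lambda>r s. kron A B $$ (r, s)) (prod_vec m a b) (prod_vec m c d)
    = sform n (\<lambda>i j. A $$ (i, j)) a c * sform m (\<lambda>i j. B $$ (i, j)) b d"
proof -
  have "sform (n * m) (\<lambda>r s. kron A B $$ (r, s)) (prod_vec m a b) (prod_vec m c d)
    = (\<Sum>i<n. \<Sum>k<m. \<Sum>j<n. \<Sum>l<m. (cnj (a i) * A $$ (i, j) * c j) * (cnj (b k) * B $$ (k, l) * d l))"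
    unfolding sform_mult
    by (intro sum.cong refl) (simp add: prod_vec_def kron_index[OF assms])
  also have "\<dots> = (\<Sum>i<n. \<Sum>j<n. \<Sum>k<m. \<Sum>l<m. (cnj (a i) * A $$ (i, j) * c j) * (cnj (b k) * B $$ (k, l) * d l))"
    by (rule sum.cong[OF refl], rule sum.swap)
  also have "\<dots> = sform n (\<lambda>i j. A $$ (i, j)) a c * sform m (\<lambda>i j. B $$ (i, j)) b d"
    unfolding sform_def by (simp only: sum_distrib_right) (simp only: sum_distrib_left)
  finally show ?thesis .
qed

lemma sform_cong:
  "(\<And>i j. i < n \<Longrightarrow> j < n \<Longrightarrow> A i j = B i j) \<Longrightarrow> sform n A x y = sform n B x y"
  by (simp add: sform_def)

lemma sform_tensor_map:
  assumes \<Phi>: "linear_map n \<Phi>" and \<Psi>: "linear_map m \<Psi>"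
  shows "sform (n * m) (\<lambda>r s. tensor_map n m \<Phi> \<Psi> X $$ (r, s)) (prod_vec m a b) (prod_vec m c d)
    = (\<Sum>i<n. \<Sum>j<n. \<Sum>k<m. \<Sum>l<m. X $$ (i * m + k, j * m + l) *
        (sform n (\<lambda>r s. \<Phi> (unit_op n i j) $$ (r, s)) a c *
         sform m (\<lambda>r s. \<Psi> (unit_op m k l) $$ (r, s)) b d))"
proof -
  have "sform (n * m) (\<lambda>r s. tensor_map n m \<Phi> \<Psi> X $$ (r, s)) (prod_vec m a b) (prod_vec m c d)
    = sform (n * m) (\<lambda>r s. \<Sum>i<n. \<Sum>j<n. \<Sum>k<m. \<Sum>l<m. X $$ (i * m + k, j * m + l) *
        kron (\<Phi> (unit_op n i j)) (\<Psi> (unit_op m k l)) $$ (r, s)) (prod_vec m a b) (prod_vec m c d)"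
    by (rule sform_cong) (simp add: tensor_map_def)
  then show ?thesis
    unfolding sform_sum_form sform_scale_form
      sform_kron[OF linear_map_carrier[OF \<Phi> unit_op_carrier] linear_map_carrier[OF \<Psi> unit_op_carrier]] .
qed

lemma sum_matrix_element_product:
  "(\<Sum>i<n. \<Sum>j<n. \<Sum>k<m. \<Sum>l<m. x i * x' k * cnj (y j * y' l) *
     (sform n (\<lambda>r s. \<Phi> (unit_op n i j) $$ (r, s)) a c *
      sform m (\<lambda>r s. \<Psi> (unit_op m k l) $$ (r, s)) b d))
   = matrix_element n \<Phi> x y a c * matrix_element m \<Psi> x' y' b d"
proof -
  have "matrix_element n \<Phi> x y a c * matrix_element m \<Psi> x' y' b d
    = (\<Sum>i<n. \<Sum>j<n. \<Sum>k<m. \<Sum>l<m.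
       (x i * cnj (y j) * sform n (\<lambda>r s. \<Phi> (unit_op n i j) $$ (r, s)) a c) *
       (x' k * cnj (y' l) * sform m (\<lambda>r s. \<Psi> (unit_op m k l) $$ (r, s)) b d))"
    unfolding matrix_element_def by (simp only: sum_distrib_right) (simp only: sum_distrib_left)
  then show ?thesis by (simp add: mult_ac)
qed

text \<open>The assumption on \<open>X\<close> says that it is the projector, up to scale, onto
  \<open>x \<otimes> x' + e (y \<otimes> y')\<close>. Expanding it gives four product operators, and
  on each of them the matrix element factorizes.\<close>

lemma sform_tensor_map_superposition:
  fixes e :: real
  assumes \<Phi>: "linear_map n \<Phi>" and \<Psi>: "linear_map m \<Psi>"
    and X: "\<And>i j k l. i < n \<Longrightarrow> j < n \<Longrightarrow> k < m \<Longrightarrow> l < m \<Longrightarrow>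
      X $$ (i * m + k, j * m + l) = (x i * x' k + of_real e * (y i * y' k)) * cnj (x j * x' l + of_real e * (y j * y' l))"
  shows "sform (n * m) (\<lambda>r s. tensor_map n m \<Phi> \<Psi> X $$ (r, s)) (prod_vec m a b) (prod_vec m c d)
    = matrix_element n \<Phi> x x a c * matrix_element m \<Psi> x' x' b d
      + of_real e * (matrix_element n \<Phi> x y a c * matrix_element m \<Psi> x' y' b d)
      + of_real e * (matrix_element n \<Phi> y x a c * matrix_element m \<Psi> y' x' b d)
      + of_real (e\<^sup>2) * (matrix_element n \<Phi> y y a c * matrix_element m \<Psi> y' y' b d)"
proof -
  define W where "W i j k l = sform n (\<lambda>r s. \<Phi> (unit_op n i j) $$ (r, s)) a c *
      sform m (\<lambda>r s. \<Psi> (unit_op m k l) $$ (r, s)) b d" for i j k l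
  define t where "t f f' g g' i j k l = f i * f' k * cnj (g j * g' l)" for f f' g g' :: "nat \<Rightarrow> complex" and i j k l
  have "(\<Sum>i<n. \<Sum>j<n. \<Sum>k<m. \<Sum>l<m. X $$ (i * m + k, j * m + l) * W i j k l)
    = (\<Sum>i<n. \<Sum>j<n. \<Sum>k<m. \<Sum>l<m. t x x' x x' i j k l * W i j k l
        + of_real e * (t x x' y y' i j k l * W i j k l) + of_real e * (t y y' x x' i j k l * W i j k l)
        + of_real (e\<^sup>2) * (t y y' y y' i j k l * W i j k l))"
    by (intro sum.cong refl) (simp only: X lessThan_iff, simp add: t_def algebra_simps power2_eq_square)
  then show ?thesis
    unfolding sform_tensor_map[OF \<Phi> \<Psi>] sum_matrix_element_product[symmetric]
    unfolding W_def[symmetric] t_def[symmetric]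
    by (simp only: sum.distrib sum_distrib_left)
qed

section \<open>An inequality for matrix elements of separable states\<close>

lemma mult_cauchy_schwarz_mean:
  fixes a b c d s t :: real
  assumes "s\<^sup>2 \<le> a * b" "t\<^sup>2 \<le> c * d" "0 \<le> a" "0 \<le> b" "0 \<le> c" "0 \<le> d"
  shows "2 * (s * t) \<le> a * d + b * c"
proof (rule power2_le_imp_le)
  have "(2 * (s * t))\<^sup>2 = 4 * (s\<^sup>2 * t\<^sup>2)" by (simp add: power_mult_distrib)
  also have "\<dots> \<le> 4 * ((a * b) * (c * d))" using assms by (intro mult_left_mono mult_mono) auto
  \<comment> \<open>The arithmetic-geometric mean inequality for \<open>a * d\<close> and
    \<open>b * c\<close>, whose product consists of the same four factors.\<close>
  also have "\<dots> \<le> (a * d + b * c)\<^sup>2"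
    using zero_le_power2[of "a * d - b * c"] by (simp add: power2_eq_square algebra_simps)
  finally show "(2 * (s * t))\<^sup>2 \<le> (a * d + b * c)\<^sup>2" .
  show "0 \<le> a * d + b * c" using assms by simp
qed

lemma separableE:
  assumes "separable n m \<rho>"
  obtains N and p :: "nat \<Rightarrow> real" and \<sigma> \<tau> where
    "\<forall>k<N. 0 \<le> p k \<and> state n (\<sigma> k) \<and> state m (\<tau> k)" "(\<Sum>k<N. p k) = 1"
    "\<rho> = mat (n * m) (n * m) (\<lambda>rs. \<Sum>k<N. complex_of_real (p k) * kron (\<sigma> k) (\<tau> k) $$ rs)"
proof -
  from assms[unfolded separable_def] show thesis
    by (elim exE conjE) (fact that)
qed

text \<open>For a product state, Cauchy-Schwarz in each factor bounds the left side by a geometric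
  mean in which the four diagonal values can be regrouped as \<open>(a, b')\<close> and
  \<open>(a', b)\<close>. Both sides behave well under convex combinations.\<close>

lemma separable_matrix_element_bound:
  assumes "separable n m \<rho>"
  shows "2 * cmod (sform (n * m) (\<lambda>r s. \<rho> $$ (r, s)) (prod_vec m a b) (prod_vec m a' b'))
    \<le> Re (sform (n * m) (\<lambda>r s. \<rho> $$ (r, s)) (prod_vec m a b') (prod_vec m a b'))
      + Re (sform (n * m) (\<lambda>r s. \<rho> $$ (r, s)) (prod_vec m a' b) (prod_vec m a' b))"
proof -
  obtain N :: nat and p \<sigma> \<tau> where
    *: "\<forall>k<N. 0 \<le> p k \<and> state n (\<sigma> k) \<and> state m (\<tau> k)"
    and "(\<Sum>k<N. p k) = 1"
    and \<rho>: "\<rho> = mat (n * m) (n * m) (\<lambda>rs. \<Sum>k<N. complex_of_real (p k) * kron (\<sigma> k) (\<tau> k) $$ rs)"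
    using assms by (rule separableE)
  have pos: "\<And>k. k < N \<Longrightarrow> 0 \<le> p k" and \<sigma>: "\<And>k. k < N \<Longrightarrow> psd n (\<sigma> k)" and \<tau>: "\<And>k. k < N \<Longrightarrow> psd m (\<tau> k)"
    using * by (simp_all add: state_def)
  define S T where "S k = sform n (\<lambda>i j. \<sigma> k $$ (i, j))" and "T k = sform m (\<lambda>i j. \<tau> k $$ (i, j))" for k
  have form: "sform (n * m) (\<lambda>r s. \<rho> $$ (r, s)) (prod_vec m x y) (prod_vec m x' y')
    = (\<Sum>k<N. of_real (p k) * (S k x x' * T k y y'))" for x y x' y'
  proof -
    have "sform (n * m) (\<lambda>r s. \<rho> $$ (r, s)) (prod_vec m x y) (prod_vec m x' y')
      = sform (n * m) (\<lambda>r s. \<Sum>k<N. of_real (p k) * kron (\<sigma> k) (\<tau> k) $$ (r, s)) (prod_vec m x y) (prod_vec m x' y')"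
      by (rule sform_cong) (simp add: \<rho>)
    also have "\<dots> = (\<Sum>k<N. of_real (p k) * (S k x x' * T k y y'))"
      unfolding sform_sum_form sform_scale_form
      using \<sigma> \<tau> by (intro sum.cong refl) (simp add: sform_kron S_def T_def psd_def)
    finally show ?thesis .
  qed
  have psd: "psd_form n (\<lambda>i j. \<sigma> k $$ (i, j))" "psd_form m (\<lambda>i j. \<tau> k $$ (i, j))" if "k < N" for k
    using \<sigma>[OF that] \<tau>[OF that] by (simp_all add: psd_iff_psd_form)
  have Im: "Im (S k x x) = 0" if "k < N" for k x
    using psd_form_eq_Re[OF psd(1)[OF that], of x] by (simp add: S_def complex_eq_iff)
  have "2 * cmod (\<Sum>k<N. of_real (p k) * (S k a a' * T k b b'))
    \<le> 2 * (\<Sum>k<N. p k * (cmod (S k a a') * cmod (T k b b')))"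
    using norm_sum[of "\<lambda>k. of_real (p k) * (S k a a' * T k b b')" "{..<N}"] pos
    by (simp add: norm_mult)
  also have "\<dots> = (\<Sum>k<N. p k * (2 * (cmod (S k a a') * cmod (T k b b'))))"
    by (simp add: sum_distrib_left mult_ac)
  also have "\<dots> \<le> (\<Sum>k<N. p k * (Re (S k a a) * Re (T k b' b') + Re (S k a' a') * Re (T k b b)))"
    unfolding S_def T_def
    by (intro sum_mono mult_left_mono mult_cauchy_schwarz_mean psd_form_cauchy_schwarz
        psd_form_Re_nonneg psd pos) auto
  also have "\<dots> = Re (\<Sum>k<N. of_real (p k) * (S k a a * T k b' b'))
      + Re (\<Sum>k<N. of_real (p k) * (S k a' a' * T k b b))"
    by (simp add: Im distrib_left sum.distrib)
  finally show ?thesis unfolding form .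
qed

section \<open>Normalisation and unnormalised inputs\<close>

lemma psd_form_trace:
  assumes "psd_form n A"
  shows "0 \<le> (\<Sum>i<n. A i i)"
  using psd_form_diag[OF assms] by (intro sum_nonneg) simp

lemma psd_form_trace_zero:
  assumes A: "psd_form n A" and "(\<Sum>i<n. A i i) = 0" and ij: "i < n" "j < n"
  shows "A i j = 0"
proof -
  have "A j j = 0"
    using assms(2) psd_form_diag[OF A] ij
    by (subst (asm) sum_nonneg_eq_0_iff) simp_all
  then show ?thesis by (rule psd_form_diag_zero[OF A ij(2,1)])
qed

lemma mtrace_carrier: "A \<in> carrier_mat n n \<Longrightarrow> mtrace A = (\<Sum>i<n. A $$ (i, i))"
  by (simp add: mtrace_def)

lemma state_normalize:
  assumes X: "psd n X" and t: "mtrace X \<noteq> 0"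
  shows "state n ((1 / mtrace X) \<cdot>\<^sub>m X)" "0 < Re (mtrace X)" "mtrace X = of_real (Re (mtrace X))"
proof -
  have C: "X \<in> carrier_mat n n" and P: "psd_form n (\<lambda>i j. X $$ (i, j))"
    using X by (simp_all add: psd_iff_psd_form)
  have "0 \<le> mtrace X" using psd_form_trace[OF P] by (simp add: mtrace_carrier[OF C])
  then show pos: "0 < Re (mtrace X)" "mtrace X = of_real (Re (mtrace X))"
    using t by (auto simp: less_eq_complex_def complex_eq_iff)
  have "0 \<le> 1 / mtrace X"
    by (subst pos(2)) (use pos(1) in \<open>simp add: less_eq_complex_def\<close>)
  then have "0 \<le> sform n (\<lambda>i j. 1 / mtrace X * X $$ (i, j)) x x" for x
    unfolding sform_scale_form using P by (intro mult_nonneg_nonneg) (simp_all add: psd_form_def)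
  then have "psd_form n (\<lambda>i j. 1 / mtrace X * X $$ (i, j))" by (simp add: psd_form_def)
  then have "psd_form n (\<lambda>i j. ((1 / mtrace X) \<cdot>\<^sub>m X) $$ (i, j))"
    using C by (subst psd_form_cong[where B = "\<lambda>i j. 1 / mtrace X * X $$ (i, j)"]) auto
  moreover have "mtrace ((1 / mtrace X) \<cdot>\<^sub>m X) = (1 / mtrace X) * mtrace X"
    using C by (simp add: mtrace_carrier[of _ n] sum_distrib_left)
  ultimately show "state n ((1 / mtrace X) \<cdot>\<^sub>m X)"
    using C t by (simp add: state_def psd_iff_psd_form)
qed

text \<open>The separability bound is homogeneous in \<open>X\<close>, so it carries over from
  states to all positive semidefinite inputs; one of trace zero is the zero matrix. A superposition
  can thus be fed in without normalising it.\<close>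

lemma entanglement_annihilating_matrix_element_bound:
  assumes \<Phi>: "linear_map n \<Phi>" and \<Psi>: "linear_map m \<Psi>"
    and EA: "entanglement_annihilating n m (tensor_map n m \<Phi> \<Psi>)" and X: "psd (n * m) X"
  defines "F x y x' y' \<equiv> sform (n * m) (\<lambda>r s. tensor_map n m \<Phi> \<Psi> X $$ (r, s)) (prod_vec m x y) (prod_vec m x' y')"
  shows "2 * cmod (F a b a' b') \<le> Re (F a b' a b') + Re (F a' b a' b)"
proof (cases "mtrace X = 0")
  case True
  have "X $$ (r, s) = 0" if "r < n * m" "s < n * m" for r s
    using X True that psd_form_trace_zero[of "n * m" "\<lambda>i j. X $$ (i, j)" r s]
    by (auto simp: psd_iff_psd_form mtrace_def)
  then have "F x y x' y' = 0" for x y x' y'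
    unfolding F_def sform_tensor_map[OF \<Phi> \<Psi>] by (simp add: index_less_mult)
  then show ?thesis by simp
next
  case False
  define t where "t = Re (mtrace X)"
  have t: "0 < t" "mtrace X = of_real t" using state_normalize(2,3)[OF X False] by (simp_all add: t_def)
  let ?Y = "(1 / mtrace X) \<cdot>\<^sub>m X"
  have C: "X \<in> carrier_mat (n * m) (n * m)" using X by (simp add: psd_def)
  have sep: "separable n m (tensor_map n m \<Phi> \<Psi> ?Y)"
    using EA state_normalize(1)[OF X False] by (simp add: entanglement_annihilating_def)
  have scale: "sform (n * m) (\<lambda>r s. tensor_map n m \<Phi> \<Psi> ?Y $$ (r, s)) (prod_vec m x y) (prod_vec m x' y')
      = of_real (1 / t) * F x y x' y'" for x y x' y'
  proof -
    have "?Y $$ (i * m + k, j * m + l) = of_real (1 / t) * X $$ (i * m + k, j * m + l)"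
      if "i < n" "k < m" "j < n" "l < m" for i j k l
      using C that index_less_mult[of i n k m] index_less_mult[of j n l m] by (simp add: t)
    then show ?thesis
      unfolding F_def sform_tensor_map[OF \<Phi> \<Psi>] sum_distrib_left
      by (intro sum.cong refl) (simp only: lessThan_iff mult.assoc)
  qed
  have "2 * ((1 / t) * cmod (F a b a' b')) \<le> (1 / t) * Re (F a b' a b') + (1 / t) * Re (F a' b a' b)"
    using separable_matrix_element_bound[OF sep, of a b a' b'] t(1)
    unfolding scale by (simp add: norm_mult norm_divide)
  then show ?thesis using t(1) by (simp add: field_simps)
qed

section \<open>Channels with a pure output\<close>

text \<open>An antilinear complement: it preserves the norm, and applied twice it gives
  \<open>- v\<close> on the indices 0 and 1.\<close>

definition perp :: "(nat \<Rightarrow> complex) \<Rightarrow> nat \<Rightarrow> complex" where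
  "perp v i = (if i = 0 then - cnj (v 1) else cnj (v 0))"

definition basis_of :: "(nat \<Rightarrow> complex) \<Rightarrow> nat \<Rightarrow> nat \<Rightarrow> complex" where
  "basis_of v k = (if k = 0 then v else perp v)"

lemma basis_of_complete:
  assumes v: "(cmod (v 0))\<^sup>2 + (cmod (v 1))\<^sup>2 = 1" and ij: "i < 2" "j < 2"
  shows "(\<Sum>k<2. basis_of v k i * cnj (basis_of v k j)) = (if i = j then 1 else 0)"
proof -
  have "v 0 * cnj (v 0) + v 1 * cnj (v 1) = 1"
    using v by (simp add: complex_norm_square[symmetric]) (metis of_real_1 of_real_add of_real_power)
  moreover have "i = 0 \<or> i = 1" "j = 0 \<or> j = 1" using ij by auto
  ultimately show ?thesis
    by (auto simp: sum_lessThan_two basis_of_def perp_def algebra_simps)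
qed

lemma basis_of_normalized:
  assumes v: "(cmod (v 0))\<^sup>2 + (cmod (v 1))\<^sup>2 = 1" and k: "k < 2"
  shows "(\<Sum>i<2. basis_of v k i * cnj (basis_of v k i)) = 1"
proof -
  have "v 0 * cnj (v 0) + v 1 * cnj (v 1) = 1"
    using basis_of_complete[OF v, of 0 0] v
    by (simp add: complex_norm_square[symmetric]) (metis of_real_1 of_real_add of_real_power)
  moreover have "k = 0 \<or> k = 1" using k by auto
  ultimately show ?thesis
    by (auto simp: sum_lessThan_two basis_of_def perp_def algebra_simps)
qed

text \<open>The resolution of the identity \<open>B\<close> is inserted on both sides of
  \<open>M\<close>.\<close>

lemma complete_basis_expand:
  fixes B :: "nat \<Rightarrow> nat \<Rightarrow> complex"
  assumes B: "\<And>i j. i < 2 \<Longrightarrow> j < 2 \<Longrightarrow> (\<Sum>k<2. B k i * cnj (B k j)) = (if i = j then 1 else 0)"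
    and rs: "r < 2" "s < 2"
  shows "M r s = (\<Sum>k<2. \<Sum>l<2. B k r * cnj (B l s) * sform 2 M (B k) (B l))"
proof -
  have "(\<Sum>k<2. \<Sum>l<2. B k r * cnj (B l s) * sform 2 M (B k) (B l))
    = (\<Sum>i<2. \<Sum>j<2. (\<Sum>k<2. B k r * cnj (B k i)) * M i j * (\<Sum>l<2. B l j * cnj (B l s)))"
    by (simp add: sform_def sum_lessThan_two algebra_simps)
  also have "\<dots> = (\<Sum>i<2. \<Sum>j<2. if s = j then (if r = i then M i j else 0) else 0)"
    by (intro sum.cong refl) (simp add: B rs)
  finally show ?thesis using rs by simp
qed

text \<open>The traces of the second factors become the weights of the convex combination.\<close>

lemma separable_two_terms:
  assumes \<sigma>: "state n \<sigma>\<^sub>1" "state n \<sigma>\<^sub>2" and \<tau>: "psd m \<tau>\<^sub>1" "psd m \<tau>\<^sub>2" and tr: "mtrace \<tau>\<^sub>1 + mtrace \<tau>\<^sub>2 = 1"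
    and \<rho>: "\<rho> = mat (n * m) (n * m) (\<lambda>rs. kron \<sigma>\<^sub>1 \<tau>\<^sub>1 $$ rs + kron \<sigma>\<^sub>2 \<tau>\<^sub>2 $$ rs)"
  shows "separable n m \<rho>"
proof -
  obtain \<omega> where \<omega>: "state m \<omega>"
  proof (cases "mtrace \<tau>\<^sub>1 = 0")
    case True
    then have "mtrace \<tau>\<^sub>2 \<noteq> 0" using tr by auto
    then show ?thesis using state_normalize(1)[OF \<tau>(2)] that by blast
  qed (use state_normalize(1)[OF \<tau>(1)] that in blast)
  \<comment> \<open>A positive semidefinite matrix of trace zero is zero and cannot be normalised.
    It receives weight 0, and the dummy state \<open>\<omega>\<close> takes its place.\<close>
  define \<nu> where "\<nu> \<tau> = (if mtrace \<tau> = 0 then \<omega> else (1 / mtrace \<tau>) \<cdot>\<^sub>m \<tau>)" for \<tau>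
  have \<nu>: "state m (\<nu> \<tau>)" "0 \<le> Re (mtrace \<tau>)" "mtrace \<tau> = of_real (Re (mtrace \<tau>))" if "psd m \<tau>" for \<tau>
    using that state_normalize[OF that] \<omega> by (cases "mtrace \<tau> = 0"; simp add: \<nu>_def)+
  have kr: "of_real (Re (mtrace \<tau>)) * kron \<sigma> (\<nu> \<tau>) $$ (r, s) = kron \<sigma> \<tau> $$ (r, s)"
    if \<tau>: "psd m \<tau>" and \<sigma>: "state n \<sigma>" and rs: "r < n * m" "s < n * m" for \<tau> \<sigma> r s
  proof -
    have C: "\<sigma> \<in> carrier_mat n n" "\<tau> \<in> carrier_mat m m" "\<nu> \<tau> \<in> carrier_mat m m"
      using \<tau> \<sigma> \<nu>(1)[OF \<tau>] by (auto simp: state_def psd_def)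
    have m: "0 < m" using rs by (cases m) auto
    have "mtrace \<tau> * \<nu> \<tau> $$ (k, l) = \<tau> $$ (k, l)" if "k < m" "l < m" for k l
      using C \<tau> that psd_form_trace_zero[of m "\<lambda>i j. \<tau> $$ (i, j)" k l]
      by (auto simp: \<nu>_def psd_iff_psd_form mtrace_carrier)
    from this[of "r mod m" "s mod m"] m
    have "mtrace \<tau> * \<nu> \<tau> $$ (r mod m, s mod m) = \<tau> $$ (r mod m, s mod m)" by simp
    then show ?thesis
      using C rs by (simp add: kron_def \<nu>(3)[OF \<tau>, symmetric] mult_ac)
  qed
  define p where "p k = Re (mtrace (if k = 0 then \<tau>\<^sub>1 else \<tau>\<^sub>2))" for k :: nat
  show ?thesis
    unfolding separable_def
  proof (intro exI conjI)
    show "\<forall>a<2. 0 \<le> p a \<and> state n (if a = 0 then \<sigma>\<^sub>1 else \<sigma>\<^sub>2) \<and> state m (if a = 0 then \<nu> \<tau>\<^sub>1 else \<nu> \<tau>\<^sub>2)"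
      using \<sigma> \<tau> \<nu> by (auto simp: p_def)
    show "(\<Sum>a<2. p a) = 1"
      using arg_cong[OF tr, of Re] by (simp add: sum_lessThan_two p_def)
    show "\<rho> = mat (n * m) (n * m) (\<lambda>rs. \<Sum>a<2. complex_of_real (p a) *
        kron (if a = 0 then \<sigma>\<^sub>1 else \<sigma>\<^sub>2) (if a = 0 then \<nu> \<tau>\<^sub>1 else \<nu> \<tau>\<^sub>2) $$ rs)"
      unfolding \<rho> by (rule eq_matI) (simp_all add: sum_lessThan_two p_def kr \<sigma> \<tau>)
  qed
qed

text \<open>Since \<open>\<Phi>\<close> preserves the trace, the assumption \<open>null\<close> says that \<open>\<Phi>\<close> maps \<open>v v\<^sup>*\<close> to \<open>w w\<^sup>*\<close>.\<close>

locale pure_output_channel =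
  fixes \<Phi> :: "complex mat \<Rightarrow> complex mat" and v w :: "nat \<Rightarrow> complex"
  assumes channel: "channel 2 \<Phi>"
    and v: "(cmod (v 0))\<^sup>2 + (cmod (v 1))\<^sup>2 = 1" and w: "(cmod (w 0))\<^sup>2 + (cmod (w 1))\<^sup>2 = 1"
    and null: "matrix_element 2 \<Phi> v v (perp w) (perp w) = 0"
begin

definition coherence :: complex where
  "coherence = matrix_element 2 \<Phi> (perp v) v (perp w) w"

lemma linear: "linear_map 2 \<Phi>"
  using channel by (simp add: channel_def)

lemma psd_choi: "psd_form (2 * 2) (choi 2 \<Phi>)"
  using channel by (intro psd_form_choi) (simp_all add: channel_def)

lemma matrix_element_cnj: "matrix_element 2 \<Phi> y x b a = cnj (matrix_element 2 \<Phi> x y a b)"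
  unfolding matrix_element_choi by (rule psd_form_hermitian[OF psd_choi])

text \<open>By \<open>null\<close>, the product of \<open>perp w\<close> with the conjugate of
  \<open>v\<close> is a null vector of the positive Choi form, and the form vanishes whenever one
  argument is a null vector.\<close>

lemma matrix_element_null:
  "matrix_element 2 \<Phi> v y (perp w) b = 0" "matrix_element 2 \<Phi> x v a (perp w) = 0"
  using psd_form_null[OF psd_choi] null unfolding matrix_element_choi by blast+

lemma trace_unit_op: "i < 2 \<Longrightarrow> j < 2 \<Longrightarrow> (\<Sum>r<2. \<Phi> (unit_op 2 i j) $$ (r, r)) = (if i = j then 1 else 0)"
  using channel by (intro trace_preserving_unit_op) (simp_all add: channel_def)

definition block :: "nat \<Rightarrow> nat \<Rightarrow> nat \<Rightarrow> nat \<Rightarrow> complex" where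
  "block k l r s = (\<Sum>i<2. \<Sum>j<2. basis_of v k i * cnj (basis_of v l j) * \<Phi> (unit_op 2 i j) $$ (r, s))"

lemma sform_block: "sform 2 (block k l) a b = matrix_element 2 \<Phi> (basis_of v k) (basis_of v l) a b"
  unfolding block_def[abs_def] matrix_element_def sform_sum_form sform_scale_form ..

lemma block_trace:
  assumes "k < 2"
  shows "(\<Sum>r<2. block k k r r) = 1"
proof -
  have "(\<Sum>r<2. block k k r r)
    = (\<Sum>i<2. \<Sum>j<2. basis_of v k i * cnj (basis_of v k j) * (\<Sum>r<2. \<Phi> (unit_op 2 i j) $$ (r, r)))"
    by (simp add: block_def sum_lessThan_two algebra_simps)
  also have "\<dots> = (\<Sum>i<2. \<Sum>j<2. if j = i then basis_of v k i * cnj (basis_of v k j) else 0)"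
    by (intro sum.cong refl) (simp add: trace_unit_op)
  also have "\<dots> = 1" using basis_of_normalized[OF v assms] by simp
  finally show ?thesis .
qed

lemma unit_op_block:
  assumes "i < 2" "j < 2"
  shows "\<Phi> (unit_op 2 i j) $$ (r, s)
    = (\<Sum>k<2. \<Sum>l<2. cnj (basis_of v k i) * basis_of v l j * block k l r s)"
proof -
  \<comment> \<open>\<open>block\<close> pairs the matrix units with the conjugated basis, so the
    expansion uses the completeness of that basis.\<close>
  have "(\<Sum>k<2. cnj (basis_of v k i) * cnj (cnj (basis_of v k j))) = (if i = j then 1 else 0)"
    if "i < 2" "j < 2" for i j
    using basis_of_complete[OF v that(2,1)] by (simp add: mult.commute eq_commute)
  from complete_basis_expand[where B = "\<lambda>k i. cnj (basis_of v k i)", OF this assms,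
      of "\<lambda>i j. \<Phi> (unit_op 2 i j) $$ (r, s)"]
  show ?thesis by (simp add: block_def sform_def mult_ac)
qed

lemma output_expand:
  assumes "r < 2" "s < 2"
  shows "M r s = (\<Sum>k<2. \<Sum>l<2. basis_of w k r * cnj (basis_of w l s) *
    sform 2 M (basis_of w k) (basis_of w l))"
  by (rule complete_basis_expand[OF basis_of_complete[OF w] assms])

text \<open>In the output basis \<open>w\<close>, \<open>perp w\<close>, the matrix
  \<open>block 1 0\<close> has a zero column at \<open>perp w\<close> by
  \<open>matrix_element_null\<close>, and its other off-diagonal entry is \<open>coherence\<close>.
  Since \<open>v\<close> and \<open>perp v\<close> are orthogonal, its trace is zero, which removes
  the entry at \<open>(w, w)\<close>.\<close>

lemma block_off_diagonal:
  assumes c: "coherence = 0" and rs: "r < 2" "s < 2"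
  shows "block 1 0 r s = 0" "block 0 1 r s = 0"
proof -
  have tr: "(\<Sum>r<2. block 1 0 r r) = 0"
  proof -
    have "(\<Sum>r<2. block 1 0 r r)
      = (\<Sum>i<2. \<Sum>j<2. basis_of v 1 i * cnj (basis_of v 0 j) * (\<Sum>r<2. \<Phi> (unit_op 2 i j) $$ (r, r)))"
      by (simp add: block_def sum_lessThan_two algebra_simps)
    also have "\<dots> = (\<Sum>i<2. \<Sum>j<2. if j = i then basis_of v 1 i * cnj (basis_of v 0 j) else 0)"
      by (intro sum.cong refl) (simp add: trace_unit_op)
    also have "\<dots> = 0" by (simp add: sum_lessThan_two basis_of_def perp_def)
    finally show ?thesis .
  qed
  \<comment> \<open>The trace is carried over from the standard basis to the basis \<open>w\<close>,
    \<open>perp w\<close>.\<close>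
  have "(\<Sum>k<2. sform 2 (block 1 0) (basis_of w k) (basis_of w k))
    = (\<Sum>r<2. \<Sum>s<2. (\<Sum>k<2. basis_of w k s * cnj (basis_of w k r)) * block 1 0 r s)"
    by (simp add: sform_def sum_lessThan_two algebra_simps)
  also have "\<dots> = (\<Sum>r<2. \<Sum>s<2. if s = r then block 1 0 r s else 0)"
    by (intro sum.cong refl) (simp add: basis_of_complete[OF w])
  also have "\<dots> = 0" using tr by simp
  finally have "sform 2 (block 1 0) (basis_of w k) (basis_of w l) = 0" if "k < 2" "l < 2" for k l
    using that matrix_element_null c
    by (auto simp: less_2_cases_iff sum_lessThan_two sform_block basis_of_def coherence_def)
  then have z: "block 1 0 r s = 0" if "r < 2" "s < 2" for r s
    by (subst output_expand[OF that]) simp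
  show "block 1 0 r s = 0" by (rule z[OF rs])
  \<comment> \<open>Hermiticity of the Choi form makes \<open>block 0 1\<close> the adjoint of
    \<open>block 1 0\<close>.\<close>
  have "sform 2 (block 1 0) a b = 0" for a b
    using z by (simp add: sform_def)
  then have "sform 2 (block 0 1) a b = 0" for a b
    using matrix_element_cnj[of "basis_of v 0" "basis_of v 1" a b] by (simp add: sform_block)
  then show "block 0 1 r s = 0"
    by (subst output_expand[OF rs]) simp
qed

definition block_state :: "nat \<Rightarrow> complex mat" where
  "block_state k = mat 2 2 (\<lambda>(r, s). block k k r s)"

lemma state_block:
  assumes "k < 2"
  shows "state 2 (block_state k)"
proof -
  have "0 \<le> sform 2 (block k k) x x" for x
    unfolding sform_block matrix_element_choi using psd_choi by (simp add: psd_form_def)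
  then have "psd_form 2 (\<lambda>i j. block_state k $$ (i, j))"
    by (subst psd_form_cong[where B = "block k k"]) (simp_all add: psd_form_def block_state_def)
  moreover have "mtrace (block_state k) = 1"
    using block_trace[OF assms] by (simp add: mtrace_def block_state_def)
  ultimately show ?thesis by (simp add: state_def psd_iff_psd_form block_state_def)
qed

text \<open>Without off-diagonal blocks, \<Phi> measures in the basis \<open>v\<close>,
  \<open>perp v\<close> and prepares \<open>block_state k\<close> on outcome \<open>k\<close>. The
  joint output is therefore the sum of the two products of \<open>block_state k\<close> with the
  conditional ancilla operators.\<close>

lemma entanglement_breaking_if_no_coherence:
  assumes c: "coherence = 0"
  shows "entanglement_breaking 2 \<Phi>"
  unfolding entanglement_breaking_def
proof (intro allI impI)
  fix d \<rho> assume \<rho>: "state (2 * d) \<rho>"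
  then have P: "psd_form (2 * d) (\<lambda>i j. \<rho> $$ (i, j))" and tr: "mtrace \<rho> = 1" and C: "\<rho> \<in> carrier_mat (2 * d) (2 * d)"
    by (simp_all add: state_def psd_iff_psd_form)
  \<comment> \<open>The unnormalised ancilla state conditional on outcome \<open>k\<close>, that is,
    the partial expectation of \<rho> at the basis vector \<open>k\<close>. Its trace is the
    probability of the outcome.\<close>
  define \<tau> where "\<tau> k = mat d d (\<lambda>(a, b). \<Sum>i<2. \<Sum>j<2.
      cnj (basis_of v k i) * \<rho> $$ (i * d + a, j * d + b) * basis_of v k j)" for k
  have psd: "psd d (\<tau> k)" for k
  proof -
    have "sform d (\<lambda>a b. \<tau> k $$ (a, b)) x x
      = sform (2 * d) (\<lambda>i j. \<rho> $$ (i, j)) (prod_vec d (basis_of v k) x) (prod_vec d (basis_of v k) x)" for x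
    proof -
      have "sform d (\<lambda>a b. \<tau> k $$ (a, b)) x x = (\<Sum>a<d. \<Sum>b<d. \<Sum>i<2. \<Sum>j<2.
          cnj (basis_of v k i * x a) * \<rho> $$ (i * d + a, j * d + b) * (basis_of v k j * x b))"
        unfolding sform_def
        by (intro sum.cong refl) (simp add: \<tau>_def sum_distrib_left sum_distrib_right mult_ac)
      also have "\<dots> = (\<Sum>i<2. \<Sum>a<d. \<Sum>j<2. \<Sum>b<d.
          cnj (basis_of v k i * x a) * \<rho> $$ (i * d + a, j * d + b) * (basis_of v k j * x b))"
        by (simp add: sum_lessThan_two sum.distrib)
      finally show ?thesis unfolding sform_mult by (simp add: prod_vec_def)
    qed
    then have "psd_form d (\<lambda>a b. \<tau> k $$ (a, b))" using P by (simp add: psd_form_def)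
    then show ?thesis by (simp add: psd_iff_psd_form \<tau>_def)
  qed
  have "mtrace (\<tau> 0) + mtrace (\<tau> 1) = (\<Sum>k<2. \<Sum>a<d. \<Sum>i<2. \<Sum>j<2.
      cnj (basis_of v k i) * \<rho> $$ (i * d + a, j * d + a) * basis_of v k j)"
    by (simp add: sum_lessThan_two mtrace_def \<tau>_def)
  also have "\<dots> = (\<Sum>i<2. \<Sum>a<d. \<Sum>j<2. (\<Sum>k<2. basis_of v k j * cnj (basis_of v k i)) * \<rho> $$ (i * d + a, j * d + a))"
    by (simp add: sum_lessThan_two sum.distrib algebra_simps)
  also have "\<dots> = (\<Sum>i<2. \<Sum>a<d. \<Sum>j<2. if j = i then \<rho> $$ (i * d + a, j * d + a) else 0)"
    by (intro sum.cong refl) (simp add: basis_of_complete[OF v])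
  also have "\<dots> = mtrace \<rho>" using C by (simp add: mtrace_def sum_lessThan_mult)
  finally have trace: "mtrace (\<tau> 0) + mtrace (\<tau> 1) = 1" using tr by simp
  show "separable 2 d (tensor_map 2 d \<Phi> (\<lambda>Y. Y) \<rho>)"
  proof (rule separable_two_terms[OF state_block[of 0] state_block[of 1] psd[of 0] psd[of 1] trace])
    show "tensor_map 2 d \<Phi> (\<lambda>Y. Y) \<rho> = mat (2 * d) (2 * d)
        (\<lambda>rs. kron (block_state 0) (\<tau> 0) $$ rs + kron (block_state 1) (\<tau> 1) $$ rs)"
    proof (rule eq_matI; simp)
      show "dim_row (tensor_map 2 d \<Phi> (\<lambda>Y. Y) \<rho>) = 2 * d" "dim_col (tensor_map 2 d \<Phi> (\<lambda>Y. Y) \<rho>) = 2 * d"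
        by (simp_all add: tensor_map_def)
      fix m n assume mn: "m < 2 * d" "n < 2 * d"
      define r s a b where "r = m div d" and "s = n div d" and "a = m mod d" and "b = n mod d"
      have d: "0 < d" using mn by (cases d) auto
      have lt: "r < 2" "s < 2" "a < d" "b < d"
        using mn d by (auto simp: r_def s_def a_def b_def less_mult_imp_div_less)
      have eq: "m = r * d + a" "n = s * d + b" by (simp_all add: r_def s_def a_def b_def)
      have C2: "block_state k \<in> carrier_mat 2 2" "\<tau> k \<in> carrier_mat d d" for k
        by (simp_all add: block_state_def \<tau>_def)
      have U: "\<Phi> (unit_op 2 i j) $$ (r, s) = cnj (basis_of v 0 i) * basis_of v 0 j * block 0 0 r s
          + cnj (basis_of v 1 i) * basis_of v 1 j * block 1 1 r s" if "i < 2" "j < 2" for i j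
        using unit_op_block[OF that, of r s] block_off_diagonal[OF c lt(1,2)]
        by (simp add: sum_lessThan_two)
      have "tensor_map 2 d \<Phi> (\<lambda>Y. Y) \<rho> $$ (m, n)
        = block 0 0 r s * \<tau> 0 $$ (a, b) + block 1 1 r s * \<tau> 1 $$ (a, b)"
        unfolding eq tensor_map_id_index[OF linear lt] using lt
        by (simp add: U \<tau>_def sum_lessThan_two algebra_simps)
      then show "tensor_map 2 d \<Phi> (\<lambda>Y. Y) \<rho> $$ (m, n)
        = kron (block_state 0) (\<tau> 0) $$ (m, n) + kron (block_state (Suc 0)) (\<tau> (Suc 0)) $$ (m, n)"
        unfolding eq kron_index[OF C2 lt] using lt by (simp add: block_state_def)
    qed
  qed auto
qed

end

text \<open>The input \<open>v \<otimes> v' + e (v\<^sup>\<bottom> \<otimes> v'\<^sup>\<bottom>)\<close> gives a coherence of order \<open>e\<close> between two product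
  vectors, whereas the populations bounding it for a separable output are of order \<open>e\<^sup>2\<close>.\<close>

lemma no_coherence_if_entanglement_annihilating:
  assumes P1: "pure_output_channel \<Phi> v w" and P2: "pure_output_channel \<Psi> v' w'"
    and EA: "entanglement_annihilating 2 2 (tensor_map 2 2 \<Phi> \<Psi>)"
  shows "pure_output_channel.coherence \<Phi> v w = 0 \<or> pure_output_channel.coherence \<Psi> v' w' = 0"
proof -
  interpret A: pure_output_channel \<Phi> v w by (rule P1)
  interpret B: pure_output_channel \<Psi> v' w' by (rule P2)
  \<comment> \<open>\<open>c\<close> and \<open>s\<close> are the coefficients of \<open>e\<close>
    and \<open>e\<^sup>2\<close> in the matrix element between \<open>w \<otimes> w'\<close> and
    \<open>perp w \<otimes> perp w'\<close>; \<open>K\<close> is the coefficient of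
    \<open>e\<^sup>2\<close> in the sum of the two bounding populations.\<close>
  define c where "c = cnj A.coherence * cnj B.coherence"
  define s where "s = matrix_element 2 \<Phi> (perp v) (perp v) w (perp w) * matrix_element 2 \<Psi> (perp v') (perp v') w' (perp w')"
  define K where "K = Re (matrix_element 2 \<Phi> (perp v) (perp v) w w * matrix_element 2 \<Psi> (perp v') (perp v') (perp w') (perp w'))
    + Re (matrix_element 2 \<Phi> (perp v) (perp v) (perp w) (perp w) * matrix_element 2 \<Psi> (perp v') (perp v') w' w')"
  have coh: "matrix_element 2 \<Phi> v (perp v) w (perp w) = cnj A.coherence"
    "matrix_element 2 \<Psi> v' (perp v') w' (perp w') = cnj B.coherence"
    by (simp_all add: A.coherence_def B.coherence_def
        A.matrix_element_cnj[of "perp v" v "perp w" w] B.matrix_element_cnj[of "perp v'" v' "perp w'" w'])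
  have bound: "2 * cmod (of_real e * c + of_real (e\<^sup>2) * s) \<le> e\<^sup>2 * K" for e :: real
  proof -
    define \<psi> where "\<psi> r = prod_vec 2 v v' r + of_real e * prod_vec 2 (perp v) (perp v') r" for r
    define X where "X = mat (2 * 2) (2 * 2) (\<lambda>(r, s). \<psi> r * cnj (\<psi> s))"
    have "psd_form (2 * 2) (\<lambda>i j. X $$ (i, j))"
      using psd_form_rank_one[of "2 * 2" \<psi>]
      by (subst psd_form_cong[where B = "\<lambda>i j. \<psi> i * cnj (\<psi> j)"]) (auto simp: X_def)
    then have X: "psd (2 * 2) X" by (simp add: psd_iff_psd_form X_def)
    have entry: "X $$ (i * 2 + k, j * 2 + l) = (v i * v' k + of_real e * (perp v i * perp v' k)) *
        cnj (v j * v' l + of_real e * (perp v j * perp v' l))"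
      if "i < 2" "j < 2" "k < 2" "l < 2" for i j k l
      using that index_less_mult[of i 2 k 2] index_less_mult[of j 2 l 2]
      by (simp add: X_def \<psi>_def prod_vec_def)
    have superposition: "sform (2 * 2) (\<lambda>r s. tensor_map 2 2 \<Phi> \<Psi> X $$ (r, s)) (prod_vec 2 a b) (prod_vec 2 a' b')
      = matrix_element 2 \<Phi> v v a a' * matrix_element 2 \<Psi> v' v' b b'
        + of_real e * (matrix_element 2 \<Phi> v (perp v) a a' * matrix_element 2 \<Psi> v' (perp v') b b')
        + of_real e * (matrix_element 2 \<Phi> (perp v) v a a' * matrix_element 2 \<Psi> (perp v') v' b b')
        + of_real (e\<^sup>2) * (matrix_element 2 \<Phi> (perp v) (perp v) a a' * matrix_element 2 \<Psi> (perp v') (perp v') b b')"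
      for a b a' b'
      by (rule sform_tensor_map_superposition[OF A.linear B.linear entry])
    \<comment> \<open>In the populations at \<open>w \<otimes> perp w'\<close> and
      \<open>perp w \<otimes> w'\<close>, every term of order below two has a factor that vanishes
      by \<open>matrix_element_null\<close>. On the left, the constant term and one of the two
      linear terms vanish likewise.\<close>
    have "2 * cmod (of_real e * c + of_real (e\<^sup>2) * s)
      \<le> Re (of_real (e\<^sup>2) * (matrix_element 2 \<Phi> (perp v) (perp v) w w * matrix_element 2 \<Psi> (perp v') (perp v') (perp w') (perp w')))
      + Re (of_real (e\<^sup>2) * (matrix_element 2 \<Phi> (perp v) (perp v) (perp w) (perp w) * matrix_element 2 \<Psi> (perp v') (perp v') w' w'))"
      using entanglement_annihilating_matrix_element_bound[OF A.linear B.linear EA X, of w w' "perp w" "perp w'"]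
      unfolding superposition
        A.matrix_element_null B.matrix_element_null coh c_def s_def
      by (simp only: mult_zero_left mult_zero_right add_0_left add_0_right)
    also have "\<dots> = e\<^sup>2 * K"
    proof -
      have "Re (complex_of_real r * z) = r * Re z" for r z by simp
      then show ?thesis unfolding K_def by (simp only: distrib_left)
    qed
    finally show ?thesis .
  qed
  have "c = 0"
  proof (rule ccontr)
    assume "c \<noteq> 0"
    \<comment> \<open>\<open>L\<close> is positive and at least \<open>K + 2 * cmod s\<close>. With
      \<open>e = cmod c / L\<close> the bound becomes
      \<open>2 * (e * cmod c) \<le> e * cmod c\<close>, which is absurd for
      \<open>c \<noteq> 0\<close>.\<close>
    define L where "L = \<bar>K\<bar> + 2 * cmod s + 1"
    define e where "e = cmod c / L"
    have L: "0 < L" by (simp add: L_def add_nonneg_pos)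
    have e: "0 < e" using \<open>c \<noteq> 0\<close> L by (simp add: e_def)
    have "2 * (e * cmod c) = 2 * cmod (of_real e * c)" using e by (simp add: norm_mult)
    also have "\<dots> = 2 * cmod ((of_real e * c + of_real (e\<^sup>2) * s) - of_real (e\<^sup>2) * s)" by simp
    also have "\<dots> \<le> 2 * cmod (of_real e * c + of_real (e\<^sup>2) * s) + 2 * cmod (of_real (e\<^sup>2) * s)"
      using norm_triangle_ineq4[of "of_real e * c + of_real (e\<^sup>2) * s" "of_real (e\<^sup>2) * s"] by linarith
    also have "\<dots> \<le> e\<^sup>2 * K + 2 * (e\<^sup>2 * cmod s)"
      using bound[of e] by (simp add: norm_mult norm_power)
    also have "\<dots> = e\<^sup>2 * (K + 2 * cmod s)" by (simp add: algebra_simps)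
    also have "\<dots> \<le> e\<^sup>2 * L" by (intro mult_left_mono) (auto simp: L_def)
    also have "\<dots> = e * cmod c" using L by (simp add: e_def power2_eq_square)
    finally show False using e \<open>c \<noteq> 0\<close> by simp
  qed
  then show ?thesis by (simp add: c_def)
qed

section \<open>From product null vectors to pure outputs\<close>

lemma sform_scale_null: "sform n A x x = 0 \<Longrightarrow> sform n A (\<lambda>i. c * x i) (\<lambda>i. c * x i) = 0"
  by (simp add: sform_linear)

lemma normalize_pair:
  fixes p :: "nat \<Rightarrow> complex"
  assumes "p 0 \<noteq> 0 \<or> p 1 \<noteq> 0"
  obtains c where "(cmod (c * p 0))\<^sup>2 + (cmod (c * p 1))\<^sup>2 = 1"
proof -
  define N where "N = (cmod (p 0))\<^sup>2 + (cmod (p 1))\<^sup>2"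
  have N: "0 < N" using assms by (auto simp: N_def intro: add_pos_nonneg add_nonneg_pos)
  have "(cmod (of_real (1 / sqrt N) * p 0))\<^sup>2 + (cmod (of_real (1 / sqrt N) * p 1))\<^sup>2
      = (1 / sqrt N)\<^sup>2 * N"
    unfolding norm_mult power_mult_distrib norm_of_real power2_abs N_def by (rule distrib_left[symmetric])
  also have "\<dots> = 1 / N * N" using N by (simp add: power_divide)
  finally have "(cmod (of_real (1 / sqrt N) * p 0))\<^sup>2 + (cmod (of_real (1 / sqrt N) * p 1))\<^sup>2 = 1 / N * N" .
  then show ?thesis using N that[of "of_real (1 / sqrt N)"] by simp
qed

text \<open>The product null vector of the Choi form, normalised in each factor, supplies the output
  vector orthogonal to \<open>w\<close> and the conjugate of the input vector
  \<open>v\<close>.\<close>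

lemma extremal_channel_pure_output:
  assumes "extremal_channel 2 \<Phi>"
  obtains v w where "pure_output_channel \<Phi> v w"
proof -
  obtain p q where pq: "p 0 \<noteq> 0 \<or> p 1 \<noteq> 0" "q 0 \<noteq> 0 \<or> q 1 \<noteq> (0::complex)"
    "sform (2 * 2) (choi 2 \<Phi>) (prod_vec 2 p q) (prod_vec 2 p q) = 0"
    using extremal_channel_null_vector[OF assms] by blast
  obtain c where c: "(cmod (c * p 0))\<^sup>2 + (cmod (c * p 1))\<^sup>2 = 1" using normalize_pair[OF pq(1)] .
  obtain d where d: "(cmod (d * q 0))\<^sup>2 + (cmod (d * q 1))\<^sup>2 = 1" using normalize_pair[OF pq(2)] .
  define v where "v i = cnj (d * q i)" for i
  \<comment> \<open>Since \<open>perp\<close> applied twice is a sign change, this choice makes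
    \<open>perp w\<close> equal to the normalised \<open>p\<close>.\<close>
  define w where "w i = - perp (\<lambda>i. c * p i) i" for i
  have ww: "r < 2 \<Longrightarrow> perp w r = c * p r" for r by (auto simp: w_def perp_def less_2_cases_iff)
  have "sform (2 * 2) (choi 2 \<Phi>) (prod_vec 2 (perp w) (\<lambda>i. cnj (v i))) (prod_vec 2 (perp w) (\<lambda>i. cnj (v i)))
    = sform (2 * 2) (choi 2 \<Phi>) (\<lambda>r. (c * d) * prod_vec 2 p q r) (\<lambda>r. (c * d) * prod_vec 2 p q r)"
    by (simp add: sform_def prod_vec_def ww v_def less_mult_imp_div_less mult_ac)
  also have "\<dots> = 0" by (rule sform_scale_null[OF pq(3)])
  finally have "matrix_element 2 \<Phi> v v (perp w) (perp w) = 0" by (simp add: matrix_element_choi)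
  moreover have "channel 2 \<Phi>" using assms by (rule extremal_channel_channel)
  moreover have "(cmod (v 0))\<^sup>2 + (cmod (v 1))\<^sup>2 = 1" using d unfolding v_def complex_mod_cnj .
  moreover have "(cmod (w 0))\<^sup>2 + (cmod (w 1))\<^sup>2 = 1" using c by (simp add: w_def perp_def norm_mult add.commute)
  ultimately show thesis by (intro that[of v w] pure_output_channel.intro)
qed

section \<open>Entanglement-breaking factors\<close>

text \<open>Positivity is complete positivity with an ancilla of dimension one.\<close>

lemma state_channel:
  assumes \<Phi>: "channel n \<Phi>" and \<rho>: "state n \<rho>"
  shows "state n (\<Phi> \<rho>)"
proof -
  have L: "linear_map n \<Phi>" and C: "\<rho> \<in> carrier_mat n n"
    using assms by (simp_all add: channel_def state_def psd_def)
  have "completely_positive n \<Phi>" "psd n \<rho>" using assms by (simp_all add: channel_def state_def)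
  then have "psd n (tensor_map n 1 \<Phi> (\<lambda>Y. Y) \<rho>)"
    using completely_positive_def[THEN iffD1, rule_format, of n \<Phi> 1 \<rho>] by simp
  then have "psd_form n (\<lambda>r s. tensor_map n 1 \<Phi> (\<lambda>Y. Y) \<rho> $$ (r, s))"
    by (simp add: psd_iff_psd_form)
  moreover have "tensor_map n 1 \<Phi> (\<lambda>Y. Y) \<rho> $$ (r, s) = \<Phi> \<rho> $$ (r, s)" if "r < n" "s < n" for r s
    using tensor_map_id_index[OF L that, of 0 1 0 \<rho>] linear_map_expand[OF L C that] by simp
  ultimately have "psd_form n (\<lambda>r s. \<Phi> \<rho> $$ (r, s))"
    using psd_form_cong[of n "\<lambda>r s. tensor_map n 1 \<Phi> (\<lambda>Y. Y) \<rho> $$ (r, s)" "\<lambda>r s. \<Phi> \<rho> $$ (r, s)"]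
    by simp
  then show ?thesis
    using assms C linear_map_carrier[OF L C]
    by (simp add: state_def psd_iff_psd_form channel_def trace_preserving_def)
qed

text \<open>Separability checked at split indices, the form in which \<open>tensor_map_index\<close>
  gives its entries.\<close>

lemma separableI:
  fixes N :: nat
  assumes states: "\<forall>k<N. 0 \<le> p k \<and> state n (\<sigma> k) \<and> state m (\<tau> k)" and p: "(\<Sum>k<N. p k) = 1"
    and C: "\<rho> \<in> carrier_mat (n * m) (n * m)"
    and entry: "\<And>i j k l. i < n \<Longrightarrow> j < n \<Longrightarrow> k < m \<Longrightarrow> l < m \<Longrightarrow>
      \<rho> $$ (i * m + k, j * m + l) = (\<Sum>a<N. complex_of_real (p a) * (\<sigma> a $$ (i, j) * \<tau> a $$ (k, l)))"
  shows "separable n m \<rho>"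
  unfolding separable_def
proof (intro exI conjI)
  show "\<rho> = mat (n * m) (n * m) (\<lambda>rs. \<Sum>a<N. complex_of_real (p a) * kron (\<sigma> a) (\<tau> a) $$ rs)"
  proof (rule eq_matI)
    fix r s
    assume "r < dim_row (mat (n * m) (n * m) (\<lambda>rs. \<Sum>a<N. complex_of_real (p a) * kron (\<sigma> a) (\<tau> a) $$ rs))"
      "s < dim_col (mat (n * m) (n * m) (\<lambda>rs. \<Sum>a<N. complex_of_real (p a) * kron (\<sigma> a) (\<tau> a) $$ rs))"
    then have rs: "r < n * m" "s < n * m" by simp_all
    then have m: "0 < m" by (cases m) auto
    have lt: "r div m < n" "s div m < n" "r mod m < m" "s mod m < m"
      using rs m by (auto simp: less_mult_imp_div_less)
    have "\<rho> $$ (r, s) = (\<Sum>a<N. complex_of_real (p a) *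
        (\<sigma> a $$ (r div m, s div m) * \<tau> a $$ (r mod m, s mod m)))"
      using entry[OF lt] by simp
    also have "\<dots> = (\<Sum>a<N. complex_of_real (p a) * kron (\<sigma> a) (\<tau> a) $$ (r, s))"
    proof (intro sum.cong refl)
      fix a assume "a \<in> {..<N}"
      then have "\<sigma> a \<in> carrier_mat n n" "\<tau> a \<in> carrier_mat m m"
        using states by (auto simp: state_def psd_def)
      from kron_index[OF this lt]
      show "complex_of_real (p a) * (\<sigma> a $$ (r div m, s div m) * \<tau> a $$ (r mod m, s mod m))
        = complex_of_real (p a) * kron (\<sigma> a) (\<tau> a) $$ (r, s)" by simp
    qed
    finally show "\<rho> $$ (r, s) = mat (n * m) (n * m)
        (\<lambda>rs. \<Sum>a<N. complex_of_real (p a) * kron (\<sigma> a) (\<tau> a) $$ rs) $$ (r, s)"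
      using rs by simp
  qed (use C in auto)
qed (use states p in auto)

lemma separable_entry:
  assumes "separable n m \<rho>"
  obtains N and p :: "nat \<Rightarrow> real" and \<sigma> \<tau> where
    "\<forall>k<N. 0 \<le> p k \<and> state n (\<sigma> k) \<and> state m (\<tau> k)" "(\<Sum>k<N. p k) = 1"
    "\<forall>i<n. \<forall>j<n. \<forall>k<m. \<forall>l<m.
      \<rho> $$ (i * m + k, j * m + l) = (\<Sum>a<N. complex_of_real (p a) * (\<sigma> a $$ (i, j) * \<tau> a $$ (k, l)))"
proof -
  obtain N :: nat and p \<sigma> \<tau> where
    st: "\<forall>k<N. 0 \<le> p k \<and> state n (\<sigma> k) \<and> state m (\<tau> k)" and p: "(\<Sum>k<N. p k) = 1"
    and \<rho>: "\<rho> = mat (n * m) (n * m) (\<lambda>rs. \<Sum>k<N. complex_of_real (p k) * kron (\<sigma> k) (\<tau> k) $$ rs)"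
    using assms by (rule separableE)
  have entry: "\<rho> $$ (i * m + k, j * m + l)
      = (\<Sum>a<N. complex_of_real (p a) * (\<sigma> a $$ (i, j) * \<tau> a $$ (k, l)))"
    if ij: "i < n" "j < n" "k < m" "l < m" for i j k l
  proof -
    have "kron (\<sigma> a) (\<tau> a) $$ (i * m + k, j * m + l) = \<sigma> a $$ (i, j) * \<tau> a $$ (k, l)" if "a < N" for a
      using st that ij by (intro kron_index) (auto simp: state_def psd_def)
    then show ?thesis
      using ij index_less_mult[of i n k m] index_less_mult[of j n l m] by (simp add: \<rho>)
  qed
  show thesis by (rule that[OF st p]) (use entry in blast)
qed

text \<open>\<Phi> \<otimes> \<Psi> is \<Phi> \<otimes> id followed by id \<otimes> \<Psi>. With the
  second system as ancilla the first map gives a separable state, and the second one replaces each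
  \<open>\<tau> a\<close> by the state \<open>\<Psi> (\<tau> a)\<close>.\<close>

lemma entanglement_annihilating_if_breaking_left:
  assumes \<Phi>: "linear_map n \<Phi>" and \<Psi>: "channel m \<Psi>" and EB: "entanglement_breaking n \<Phi>"
  shows "entanglement_annihilating n m (tensor_map n m \<Phi> \<Psi>)"
  unfolding entanglement_annihilating_def
proof (intro allI impI)
  fix \<rho> assume "state (n * m) \<rho>"
  then have "separable n m (tensor_map n m \<Phi> (\<lambda>Y. Y) \<rho>)"
    using EB by (simp add: entanglement_breaking_def)
  then obtain N and p :: "nat \<Rightarrow> real" and \<sigma> \<tau> where
    st: "\<forall>k<N. 0 \<le> p k \<and> state n (\<sigma> k) \<and> state m (\<tau> k)" and p: "(\<Sum>k<N. p k) = 1"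
    and entry: "\<forall>i<n. \<forall>j<n. \<forall>k<m. \<forall>l<m.
      tensor_map n m \<Phi> (\<lambda>Y. Y) \<rho> $$ (i * m + k, j * m + l)
        = (\<Sum>a<N. complex_of_real (p a) * (\<sigma> a $$ (i, j) * \<tau> a $$ (k, l)))"
    by (rule separable_entry)
  have L: "linear_map m \<Psi>" using \<Psi> by (simp add: channel_def)
  show "separable n m (tensor_map n m \<Phi> \<Psi> \<rho>)"
  proof (rule separableI[where \<sigma> = \<sigma> and \<tau> = "\<lambda>a. \<Psi> (\<tau> a)", OF _ p tensor_map_carrier])
    show "\<forall>k<N. 0 \<le> p k \<and> state n (\<sigma> k) \<and> state m (\<Psi> (\<tau> k))"
      using st state_channel[OF \<Psi>] by blast
    fix r s x y assume lt: "r < n" "s < n" "x < m" "y < m"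
    have "tensor_map n m \<Phi> \<Psi> \<rho> $$ (r * m + x, s * m + y)
      = (\<Sum>k<m. \<Sum>l<m. \<Sum>i<n. \<Sum>j<n. \<rho> $$ (i * m + k, j * m + l) *
          (\<Phi> (unit_op n i j) $$ (r, s) * \<Psi> (unit_op m k l) $$ (x, y)))"
      unfolding tensor_map_index[OF \<Phi> L lt] sum.swap[where A = "{..<n}" and B = "{..<m}"] ..
    \<comment> \<open>The inner sums over \<open>i\<close> and \<open>j\<close> are an entry of
      (\<Phi> \<otimes> id) \<rho>; the outer sums apply \<Psi> to the second factor.\<close>
    also have "\<dots> = (\<Sum>k<m. \<Sum>l<m. tensor_map n m \<Phi> (\<lambda>Y. Y) \<rho> $$ (r * m + k, s * m + l) * \<Psi> (unit_op m k l) $$ (x, y))"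
      by (intro sum.cong refl) (simp add: tensor_map_id_index[OF \<Phi>] lt sum_distrib_right mult.assoc)
    also have "\<dots> = (\<Sum>k<m. \<Sum>l<m. \<Sum>a<N. complex_of_real (p a) *
        (\<sigma> a $$ (r, s) * (\<tau> a $$ (k, l) * \<Psi> (unit_op m k l) $$ (x, y))))"
      by (intro sum.cong refl) (simp add: entry lt sum_distrib_right mult.assoc)
    also have "\<dots> = (\<Sum>a<N. \<Sum>k<m. \<Sum>l<m. complex_of_real (p a) *
        (\<sigma> a $$ (r, s) * (\<tau> a $$ (k, l) * \<Psi> (unit_op m k l) $$ (x, y))))"
      unfolding sum.swap[where B = "{..<N}"] ..
    also have "\<dots> = (\<Sum>a<N. complex_of_real (p a) * (\<sigma> a $$ (r, s) * \<Psi> (\<tau> a) $$ (x, y)))"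
    proof (intro sum.cong refl)
      fix a assume "a \<in> {..<N}"
      then have "\<tau> a \<in> carrier_mat m m" using st by (simp add: state_def psd_def)
      from linear_map_expand[OF L this lt(3,4)]
      show "(\<Sum>k<m. \<Sum>l<m. complex_of_real (p a) *
          (\<sigma> a $$ (r, s) * (\<tau> a $$ (k, l) * \<Psi> (unit_op m k l) $$ (x, y))))
        = complex_of_real (p a) * (\<sigma> a $$ (r, s) * \<Psi> (\<tau> a) $$ (x, y))"
        by (simp only: sum_distrib_left)
    qed
    finally show "tensor_map n m \<Phi> \<Psi> \<rho> $$ (r * m + x, s * m + y)
      = (\<Sum>a<N. complex_of_real (p a) * (\<sigma> a $$ (r, s) * \<Psi> (\<tau> a) $$ (x, y)))" .
  qed
qed

text \<open>The flip of the tensor factors. It moves the second system to the first place, where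
  \<open>entanglement_breaking\<close> expects the system that the channel acts on.\<close>

definition swap_factors :: "nat \<Rightarrow> nat \<Rightarrow> complex mat \<Rightarrow> complex mat" where
  "swap_factors n m X = mat (m * n) (m * n)
     (\<lambda>(r, s). X $$ (r mod n * m + r div n, s mod n * m + s div n))"

lemma swap_factors_index:
  assumes "i < n" "j < n" "k < m" "l < m"
  shows "swap_factors n m X $$ (k * n + i, l * n + j) = X $$ (i * m + k, j * m + l)"
  using assms index_less_mult[of k m i n] index_less_mult[of l m j n] by (simp add: swap_factors_def)

lemma state_swap_factors:
  assumes "state (n * m) \<rho>"
  shows "state (m * n) (swap_factors n m \<rho>)"
proof -
  have P: "psd_form (n * m) (\<lambda>i j. \<rho> $$ (i, j))" and tr: "mtrace \<rho> = 1" and C: "\<rho> \<in> carrier_mat (n * m) (n * m)"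
    using assms by (simp_all add: state_def psd_iff_psd_form)
  have "sform (m * n) (\<lambda>i j. swap_factors n m \<rho> $$ (i, j)) x x
    = sform (n * m) (\<lambda>i j. \<rho> $$ (i, j)) (\<lambda>r. x (r mod m * n + r div m)) (\<lambda>r. x (r mod m * n + r div m))" for x
  proof -
    have "sform (m * n) (\<lambda>i j. swap_factors n m \<rho> $$ (i, j)) x x = (\<Sum>k<m. \<Sum>i<n. \<Sum>l<m. \<Sum>j<n.
        cnj (x (k * n + i)) * \<rho> $$ (i * m + k, j * m + l) * x (l * n + j))"
      unfolding sform_mult by (intro sum.cong refl) (simp add: swap_factors_index)
    also have "\<dots> = (\<Sum>i<n. \<Sum>k<m. \<Sum>l<m. \<Sum>j<n.
        cnj (x (k * n + i)) * \<rho> $$ (i * m + k, j * m + l) * x (l * n + j))"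
      by (rule sum.swap)
    also have "\<dots> = (\<Sum>i<n. \<Sum>k<m. \<Sum>j<n. \<Sum>l<m.
        cnj (x (k * n + i)) * \<rho> $$ (i * m + k, j * m + l) * x (l * n + j))"
      by (rule sum.cong[OF refl], rule sum.cong[OF refl], rule sum.swap)
    also have "\<dots> = sform (n * m) (\<lambda>i j. \<rho> $$ (i, j)) (\<lambda>r. x (r mod m * n + r div m)) (\<lambda>r. x (r mod m * n + r div m))"
      unfolding sform_mult by (intro sum.cong refl) simp
    finally show ?thesis .
  qed
  then have "psd_form (m * n) (\<lambda>i j. swap_factors n m \<rho> $$ (i, j))" using P by (simp add: psd_form_def)
  moreover have "mtrace (swap_factors n m \<rho>) = mtrace \<rho>"
  proof -
    have "mtrace (swap_factors n m \<rho>) = (\<Sum>r<m * n. swap_factors n m \<rho> $$ (r, r))"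
      by (simp add: mtrace_def swap_factors_def)
    also have "\<dots> = (\<Sum>k<m. \<Sum>i<n. \<rho> $$ (i * m + k, i * m + k))"
      unfolding sum_lessThan_mult by (intro sum.cong refl) (simp add: swap_factors_index)
    also have "\<dots> = (\<Sum>i<n. \<Sum>k<m. \<rho> $$ (i * m + k, i * m + k))" by (rule sum.swap)
    also have "\<dots> = mtrace \<rho>" unfolding mtrace_carrier[OF C] sum_lessThan_mult ..
    finally show ?thesis .
  qed
  ultimately show ?thesis using tr by (simp add: state_def psd_iff_psd_form swap_factors_def)
qed

text \<open>\<Psi> is applied first, to the flipped state with the first system as ancilla. The
  resulting decomposition has its factors in reverse order; reading it at flipped indices and
  applying \<Phi> to the ancilla states gives the decomposition of the output.\<close>

lemma entanglement_annihilating_if_breaking_right: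
  assumes \<Phi>: "channel n \<Phi>" and \<Psi>: "linear_map m \<Psi>" and EB: "entanglement_breaking m \<Psi>"
  shows "entanglement_annihilating n m (tensor_map n m \<Phi> \<Psi>)"
  unfolding entanglement_annihilating_def
proof (intro allI impI)
  fix \<rho> assume "state (n * m) \<rho>"
  then have "separable m n (tensor_map m n \<Psi> (\<lambda>Y. Y) (swap_factors n m \<rho>))"
    using EB state_swap_factors by (simp add: entanglement_breaking_def)
  then obtain N and p :: "nat \<Rightarrow> real" and \<tau> \<sigma> where
    st: "\<forall>k<N. 0 \<le> p k \<and> state m (\<tau> k) \<and> state n (\<sigma> k)" and p: "(\<Sum>k<N. p k) = 1"
    and entry: "\<forall>i<m. \<forall>j<m. \<forall>k<n. \<forall>l<n.
      tensor_map m n \<Psi> (\<lambda>Y. Y) (swap_factors n m \<rho>) $$ (i * n + k, j * n + l)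
        = (\<Sum>a<N. complex_of_real (p a) * (\<tau> a $$ (i, j) * \<sigma> a $$ (k, l)))"
    by (rule separable_entry)
  have L: "linear_map n \<Phi>" using \<Phi> by (simp add: channel_def)
  show "separable n m (tensor_map n m \<Phi> \<Psi> \<rho>)"
  proof (rule separableI[where \<sigma> = "\<lambda>a. \<Phi> (\<sigma> a)" and \<tau> = \<tau>, OF _ p tensor_map_carrier])
    show "\<forall>k<N. 0 \<le> p k \<and> state n (\<Phi> (\<sigma> k)) \<and> state m (\<tau> k)"
      using st state_channel[OF \<Phi>] by blast
    fix r s x y assume lt: "r < n" "s < n" "x < m" "y < m"
    have expand: "tensor_map m n \<Psi> (\<lambda>Y. Y) (swap_factors n m \<rho>) $$ (x * n + i, y * n + j)
      = (\<Sum>k<m. \<Sum>l<m. \<rho> $$ (i * m + k, j * m + l) * \<Psi> (unit_op m k l) $$ (x, y))"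
      if "i < n" "j < n" for i j
      using that by (simp add: tensor_map_id_index[OF \<Psi>] swap_factors_index lt)
    have "tensor_map n m \<Phi> \<Psi> \<rho> $$ (r * m + x, s * m + y)
      = (\<Sum>i<n. \<Sum>j<n. tensor_map m n \<Psi> (\<lambda>Y. Y) (swap_factors n m \<rho>) $$ (x * n + i, y * n + j) * \<Phi> (unit_op n i j) $$ (r, s))"
      unfolding tensor_map_index[OF L \<Psi> lt]
      by (intro sum.cong refl) (simp only: lessThan_iff expand sum_distrib_right, simp only: mult_ac)
    also have "\<dots> = (\<Sum>i<n. \<Sum>j<n. \<Sum>a<N. complex_of_real (p a) *
        (\<tau> a $$ (x, y) * (\<sigma> a $$ (i, j) * \<Phi> (unit_op n i j) $$ (r, s))))"
      by (intro sum.cong refl) (simp add: entry lt sum_distrib_right mult.assoc)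
    also have "\<dots> = (\<Sum>a<N. \<Sum>i<n. \<Sum>j<n. complex_of_real (p a) *
        (\<tau> a $$ (x, y) * (\<sigma> a $$ (i, j) * \<Phi> (unit_op n i j) $$ (r, s))))"
      unfolding sum.swap[where B = "{..<N}"] ..
    also have "\<dots> = (\<Sum>a<N. complex_of_real (p a) * (\<Phi> (\<sigma> a) $$ (r, s) * \<tau> a $$ (x, y)))"
    proof (intro sum.cong refl)
      fix a assume "a \<in> {..<N}"
      then have "\<sigma> a \<in> carrier_mat n n" using st by (simp add: state_def psd_def)
      from linear_map_expand[OF L this lt(1,2)]
      have "(\<Sum>i<n. \<Sum>j<n. complex_of_real (p a) *
          (\<tau> a $$ (x, y) * (\<sigma> a $$ (i, j) * \<Phi> (unit_op n i j) $$ (r, s))))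
        = complex_of_real (p a) * (\<tau> a $$ (x, y) * \<Phi> (\<sigma> a) $$ (r, s))"
        by (simp only: sum_distrib_left)
      then show "(\<Sum>i<n. \<Sum>j<n. complex_of_real (p a) *
          (\<tau> a $$ (x, y) * (\<sigma> a $$ (i, j) * \<Phi> (unit_op n i j) $$ (r, s))))
        = complex_of_real (p a) * (\<Phi> (\<sigma> a) $$ (r, s) * \<tau> a $$ (x, y))"
        by (simp only: mult_ac)
    qed
    finally show "tensor_map n m \<Phi> \<Psi> \<rho> $$ (r * m + x, s * m + y)
      = (\<Sum>a<N. complex_of_real (p a) * (\<Phi> (\<sigma> a) $$ (r, s) * \<tau> a $$ (x, y)))" .
  qed
qed

theorem proposition5:
  fixes E\<^sub>1 E\<^sub>2 :: "complex mat \<Rightarrow> complex mat"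
  assumes "extremal_channel 2 E\<^sub>1" and "extremal_channel 2 E\<^sub>2"
  shows "entanglement_annihilating 2 2 (tensor_map 2 2 E\<^sub>1 E\<^sub>2) \<longleftrightarrow>
         entanglement_breaking 2 E\<^sub>1 \<or> entanglement_breaking 2 E\<^sub>2"
proof
  assume EA: "entanglement_annihilating 2 2 (tensor_map 2 2 E\<^sub>1 E\<^sub>2)"
  obtain v w where P1: "pure_output_channel E\<^sub>1 v w"
    using assms(1) by (rule extremal_channel_pure_output)
  obtain v' w' where P2: "pure_output_channel E\<^sub>2 v' w'"
    using assms(2) by (rule extremal_channel_pure_output)
  show "entanglement_breaking 2 E\<^sub>1 \<or> entanglement_breaking 2 E\<^sub>2"
    using no_coherence_if_entanglement_annihilating[OF P1 P2 EA]
      pure_output_channel.entanglement_breaking_if_no_coherence[OF P1]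
      pure_output_channel.entanglement_breaking_if_no_coherence[OF P2] by blast
next
  note ch = assms[THEN extremal_channel_channel]
  then have L: "linear_map 2 E\<^sub>1" "linear_map 2 E\<^sub>2" by (simp_all add: channel_def)
  assume "entanglement_breaking 2 E\<^sub>1 \<or> entanglement_breaking 2 E\<^sub>2"
  then show "entanglement_annihilating 2 2 (tensor_map 2 2 E\<^sub>1 E\<^sub>2)"
    using entanglement_annihilating_if_breaking_left[OF L(1) ch(2)]
      entanglement_annihilating_if_breaking_right[OF ch(1) L(2)] by blast
qed

end
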